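(* Let $\mathcal{G}$ be a connected (undirected, weighted) graph on $N$ nodes with weights $\mathsf{a}_{ij}=\mathsf{a}_{ji}$ and Laplacian $\mathsf{L}$ with eigenvalues $0=\lambda_1<\lambda_2\le\dots\le\lambda_N$. For each $i\in\{1,\dots,N\}$ let $f^i:\mathbb{R}^d\to\mathbb{R}$ be differentiable and $m^i$-strongly convex ($m^i>0$), with $\nabla f^i$ being $M^i$-Lipschitz on $\mathbb{R}^d$ ($M^i>0$). Put $\underline{m}=\min_i m^i$ and $\overline{M}=\max_i M^i$. Let $\mathsf{x}^\star$ be the minimizer of $f=\sum_{i=1}^N f^i$. Given $\alpha,\beta>0$, consider the system with synchronous periodic communication every $\Delta>0$ seconds, at times $t_k=\Delta k$, $k\in\mathbb{Z}_{\ge0}$: $$\dot v^i=\alpha\beta\sum_{j=1}^N\mathsf{a}_{ij}(\hat x^i-\hat x^j),\qquad \dot x^i=-\alpha\nabla f^i(x^i)-\beta\sum_{j=1}^N\mathsf{a}_{ij}(\hat x^i-\hat x^j)-v^i,\qquad i\in\{1,\dots,N\},$$ where $\hat x^i(t)=x^i(t_k)$ for $t\in[t_k,t_{k+1})$. Let $0<\epsilon<1$ and let $\delta>0$ be such that $$\phi=\frac{1}{2\underline{m}}\overline{M}^2+\frac{1}{2\underline{m}\alpha^2}\delta-1>0 ,$$ and define $$\tau=\frac{1}{\alpha\overline{M}+1}\ln\Big(1+\frac{(\alpha\overline{M}+1)\zeta}{\alpha\overline{M}+1+\beta\lambda_N\sqrt{1+\alpha^2}\,(1+\zeta)}\Big),$$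 where $\zeta>0$ is given by $$\zeta^2=\frac{2\epsilon(1-\epsilon)\lambda_2\min\{\delta,1\}}{\alpha\beta\lambda_N^2\phi+4\alpha^2\lambda_2(1+\phi)^2}.$$ Then, if $\Delta\in(0,\tau)$, for every initial condition $x^i(0),v^i(0)\in\mathbb{R}^d$, $i\in\{1,\dots,N\}$, with $\sum_{i=1}^N v^i(0)=0$, one has $x^i(t)\to\mathsf{x}^\star$ exponentially fast as $t\to\infty$, for all $i\in\{1,\dots,N\}$, with a rate of no less than $$\frac{\tfrac14\,\epsilon\min\{\tfrac12,\delta\}}{\bar\lambda_E}>0,$$ where $\bar\lambda_E$ is the maximum eigenvalue of the matrix $E$ defined in the context, formed with the system parameters $\alpha,\beta>0$ and with $\phi=\frac{1}{2\underline{m}}\overline{M}^2+\frac{1}{2\underline{m}\alpha^2}\delta-1$.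
   Context: A weighted graph on nodes $\{1,\dots,N\}$ ($N\ge 2$) has a nonnegative adjacency matrix $\mathsf{A}=(\mathsf{a}_{ij})$ with $\mathsf{a}_{ij}>0$ iff $(i,j)$ is an edge and $\mathsf{a}_{ij}=0$ otherwise. Connected graph means undirected ($\mathsf{a}_{ij}=\mathsf{a}_{ji}$) with a path between every pair of nodes. The Laplacian is $\mathsf{L}=\mathrm{Diag}(\mathsf{d}^1_{\rm out},\dots,\mathsf{d}^N_{\rm out})-\mathsf{A}$ with $\mathsf{d}^i_{\rm out}=\sum_j\mathsf{a}_{ij}$. Let $\mathsf{R}\in\mathbb{R}^{N\times(N-1)}$ satisfy $\mathbf{1}_N^\top\mathsf{R}=0$, $\mathsf{R}^\top\mathsf{R}=I_{N-1}$ and $\mathsf{R}\mathsf{R}^\top=I_N-\frac1N\mathbf{1}_N\mathbf{1}_N^\top$, and $$E=\frac12\begin{bmatrix}\alpha(\phi+1)I_d&0&0\\0&\alpha(\phi+1)I_{(N-1)d}&I_{(N-1)d}\\0&I_{(N-1)d}&\tfrac1\alpha I_{(N-1)d}+\tfrac{\phi+1}{\beta}(\mathsf{R}^\top\mathsf{L}\mathsf{R})^{-1}\otimes I_d\end{bmatrix}$$ (the eigenvalues of $E$ do not depend on the choice of $\mathsf{R}$). A differentiable $f$ is $m$-strongly convex if $(z-x)^\top(\nabla f(z)-\nabla f(x))\ge m\|z-x\|^2$ for all $x,z$. A map $g$ is $M$-Lipschitz if $\|g(x)-g(y)\|\le M\|x-y\|$ for all $x,y$. Norms are Euclidean. Convergence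 $x^i(t)\to\mathsf{x}^\star$ exponentially fast with rate no less than $r>0$ means that there is a constant $C\ge0$ (depending on the initial condition) with $\|x^i(t)-\mathsf{x}^\star\|\le Ce^{-rt}$ for all $t\ge0$. *)

theory Defs
  imports "HOL-Analysis.Analysis"
begin

text \<open>
  Nodes are the elements of a finite type \<open>'n\<close>, so \<open>N = CARD('n)\<close>; states live in
  \<open>real^'d\<close>; the finite type \<open>'r\<close> has \<open>N - 1\<close> elements.
\<close>

definition edges :: "real^'n^'n \<Rightarrow> ('n \<times> 'n) set" where
  "edges A = {(i, j). A $ i $ j > 0}"

text \<open>Self-loops are not excluded; they cancel in the Laplacian.\<close>

definition connected_graph :: "real^'n^'n \<Rightarrow> bool" where
  "connected_graph A \<longleftrightarrow>
     (\<forall>i j. 0 \<le> A $ i $ j) \<and> (\<forall>i j. A $ i $ j = A $ j $ i) \<and>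
     (\<forall>i j. (i, j) \<in> (edges A)\<^sup>*)"

definition laplacian :: "real^'n^'n \<Rightarrow> real^'n^'n" where
  "laplacian A = (\<chi> i j. (if i = j then \<Sum>k\<in>UNIV. A $ i $ k else 0) - A $ i $ j)"

text \<open>
  \<open>lam 1 \<le> \<dots> \<le> lam N\<close> are the eigenvalues listed with multiplicity, i.e.
  the characteristic polynomial splits with exactly these roots. The values of
  \<open>lam\<close> outside \<open>{1..N}\<close> are irrelevant.
\<close>

definition sorted_eigenvalues :: "real^'n^'n \<Rightarrow> (nat \<Rightarrow> real) \<Rightarrow> bool" where
  "sorted_eigenvalues A lam \<longleftrightarrow>
     (\<forall>x. det (mat x - A) = (\<Prod>k = 1..CARD('n). x - lam k)) \<and>
     mono_on {1..CARD('n)} lam"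

definition eigenvalue :: "real^'n^'n \<Rightarrow> real \<Rightarrow> bool" where
  "eigenvalue A \<mu> \<longleftrightarrow> (\<exists>w. w \<noteq> 0 \<and> A *v w = \<mu> *\<^sub>R w)"

text \<open>Only real eigenvalues are considered: this is meant for symmetric matrices.\<close>

definition max_eigenvalue :: "real^'n^'n \<Rightarrow> real" where
  "max_eigenvalue A = Max {\<mu>. eigenvalue A \<mu>}"

definition kronecker :: "real^'n^'m \<Rightarrow> real^'q^'p \<Rightarrow> real^('n \<times> 'q)^('m \<times> 'p)" where
  "kronecker A B = (\<chi> i j. A $ fst i $ fst j * B $ snd i $ snd j)"

definition block_mat ::
  "real^'a^'c \<Rightarrow> real^'b^'c \<Rightarrow> real^'a^'e \<Rightarrow> real^'b^'e \<Rightarrow> real^('a + 'b)^('c + 'e)" where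
  "block_mat A B C D =
     (\<chi> i j. case i of
        Inl k \<Rightarrow> (case j of Inl l \<Rightarrow> A $ k $ l | Inr l \<Rightarrow> B $ k $ l)
      | Inr k \<Rightarrow> (case j of Inl l \<Rightarrow> C $ k $ l | Inr l \<Rightarrow> D $ k $ l))"

definition reduction_matrix :: "real^'r^'n \<Rightarrow> bool" where
  "reduction_matrix R \<longleftrightarrow>
     vec 1 v* R = 0 \<and>
     transpose R ** R = mat 1 \<and>
     R ** transpose R = mat 1 - (\<chi> i j. 1 / real CARD('n))"

text \<open>Recall that \<open>mat c\<close> is \<open>c\<close> times the identity matrix.\<close>

definition E_matrix ::
  "real \<Rightarrow> real \<Rightarrow> real \<Rightarrow> real^'n^'n \<Rightarrow> real^'r^'n \<Rightarrow>
   real^('d::finite + ('r \<times> 'd + 'r \<times> 'd))^('d + ('r \<times> 'd + 'r \<times> 'd))" where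
  "E_matrix \<alpha> \<beta> \<phi> L R =
     (1/2) *\<^sub>R block_mat
       (mat (\<alpha> * (\<phi> + 1))) 0
       0 (block_mat
            (mat (\<alpha> * (\<phi> + 1))) (mat 1)
            (mat 1) (mat (1 / \<alpha>) +
              ((\<phi> + 1) / \<beta>) *\<^sub>R kronecker (matrix_inv (transpose R ** L ** R)) (mat 1 :: real^'d^'d)))"

text \<open>Meaningful only at points of differentiability.\<close>

definition gradient :: "('a::real_inner \<Rightarrow> real) \<Rightarrow> 'a \<Rightarrow> 'a" where
  "gradient f x = (THE D. GDERIV f x :> D)"

lemma gradient_eqI:
  assumes "GDERIV f x :> D"
  shows "gradient f x = D"
  unfolding gradient_def
proof (rule the_equality)
  show "GDERIV f x :> D" by (fact assms)
next
  fix D' assume "GDERIV f x :> D'"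
  with assms have "(\<lambda>h. h \<bullet> D') = (\<lambda>h. h \<bullet> D)"
    unfolding gderiv_def by (rule has_derivative_unique[rotated])
  then have "(D' - D) \<bullet> D' = (D' - D) \<bullet> D" by (rule fun_cong)
  then have "(D' - D) \<bullet> (D' - D) = 0" by (simp add: inner_diff_right)
  then show "D' = D" by simp
qed

definition strongly_convex :: "real \<Rightarrow> ('a::real_inner \<Rightarrow> real) \<Rightarrow> bool" where
  "strongly_convex m f \<longleftrightarrow>
     (\<forall>x. f differentiable (at x)) \<and>
     (\<forall>x z. (z - x) \<bullet> (gradient f z - gradient f x) \<ge> m * (norm (z - x))\<^sup>2)"

definition sample_hold :: "real \<Rightarrow> (real \<Rightarrow> 'a) \<Rightarrow> real \<Rightarrow> 'a" where
  "sample_hold \<Delta> y t = y (\<Delta> * of_int \<lfloor>t / \<Delta>\<rfloor>)"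

lemma sample_hold_eq:
  assumes "\<Delta> > 0" "t \<in> {\<Delta> * real k ..< \<Delta> * real (Suc k)}"
  shows "sample_hold \<Delta> y t = y (\<Delta> * real k)"
proof -
  have "\<lfloor>t / \<Delta>\<rfloor> = int k"
    using assms by (intro floor_unique) (auto simp: field_simps)
  then show ?thesis by (simp add: sample_hold_def)
qed

text \<open>
  The right-hand side jumps at the sampling instants, so a solution is continuous on
  \<open>[0, \<infinity>)\<close> and satisfies the differential equations between consecutive instants.
\<close>

definition sampled_solution ::
  "real^'n^'n \<Rightarrow> ('n \<Rightarrow> real^'d \<Rightarrow> real) \<Rightarrow> real \<Rightarrow> real \<Rightarrow> real \<Rightarrow>
   ('n \<Rightarrow> real \<Rightarrow> real^'d) \<Rightarrow> ('n \<Rightarrow> real \<Rightarrow> real^'d) \<Rightarrow> bool" where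
  "sampled_solution A f \<alpha> \<beta> \<Delta> x v \<longleftrightarrow>
     (\<forall>i. continuous_on {0..} (x i) \<and> continuous_on {0..} (v i)) \<and>
     (\<forall>k::nat. \<forall>t \<in> {\<Delta> * real k <..< \<Delta> * real (Suc k)}. \<forall>i.
        (v i has_vector_derivative
           (\<alpha> * \<beta>) *\<^sub>R (\<Sum>j\<in>UNIV. A $ i $ j *\<^sub>R
              (sample_hold \<Delta> (x i) t - sample_hold \<Delta> (x j) t))) (at t) \<and>
        (x i has_vector_derivative
           - \<alpha> *\<^sub>R gradient (f i) (x i t)
           - \<beta> *\<^sub>R (\<Sum>j\<in>UNIV. A $ i $ j *\<^sub>R
              (sample_hold \<Delta> (x i) t - sample_hold \<Delta> (x j) t))
           - v i t) (at t))"

end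

theory Submission
  imports Defs
begin

text \<open>
  Write \<open>Y\<close> and \<open>U\<close> for the deviations of the states and of the integrators from the equilibrium
  \<open>(xstar, - \<alpha> \<nabla>f\<^sup>i(xstar))\<close>, stacked as matrices with one row per node. As the rows of \<open>U\<close> always
  sum to zero, the quadratic form of \<open>E\<close> can be written without reduced coordinates, with the
  generalised inverse \<open>R (R\<^sup>T L R)\<^sup>-\<^sup>1 R\<^sup>T\<close> of the Laplacian; it is a Lyapunov function \<open>V\<close>.
  The sampling error \<open>e\<close>, the difference between the last sampled \<open>Y\<close> and the current one, spoils
  the decay of \<open>V\<close> only if its norm exceeds \<open>\<zeta>\<close> times that of \<open>(Y, U)\<close>. A Gronwall estimate for the
  distance to the current state, run backwards in time to the last sampling instant, shows that this
  cannot happen within time \<open>\<tau>\<close>.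
\<close>

subsection \<open>Rayleigh quotients of symmetric matrices\<close>

lemma inner_symmetric_matrix:
  fixes A :: "real^'n^'n"
  assumes "transpose A = A"
  shows "x \<bullet> (A *v y) = (A *v x) \<bullet> y"
  by (metis assms dot_lmul_matrix transpose_matrix_vector)

text \<open>Moving from \<open>v\<close> a small distance against \<open>w = B *v v\<close> changes
  the form to first order by \<open>- 2 * s * (w \<bullet> w)\<close>; were \<open>w\<close>
  nonzero, the form would become negative.\<close>

lemma psd_quadratic_form_eq_0:
  fixes B :: "real^'n^'n"
  assumes sym: "transpose B = B" and psd: "\<And>x. 0 \<le> x \<bullet> (B *v x)"
    and v: "v \<bullet> (B *v v) = 0"
  shows "B *v v = 0"
proof -
  define w where "w = B *v v"
  define a where "a = w \<bullet> w"
  define b where "b = w \<bullet> (B *v w)"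
  have nn: "a \<ge> 0" "b \<ge> 0" using psd by (auto simp: a_def b_def)
  \<comment> \<open>This step size gives \<open>s * b = a - s\<close>, which turns the expansion
    \<open>- 2 * s * a + s\<^sup>2 * b\<close> into \<open>- (s * (s + a))\<close>; the
    \<open>+ 1\<close> keeps the denominator positive when \<open>b = 0\<close>.\<close>
  define s where "s = a / (b + 1)"
  have *: "v \<bullet> (B *v w) = a"
    using inner_symmetric_matrix[OF sym, of v w] by (simp add: a_def w_def)
  have "0 \<le> (v - s *\<^sub>R w) \<bullet> (B *v (v - s *\<^sub>R w))" by (rule psd)
  also have "\<dots> = - 2 * s * a + s\<^sup>2 * b"
    using v * by (simp add: matrix_vector_mult_diff_distrib matrix_vector_mult_scaleR
        inner_diff_left inner_diff_right b_def power2_eq_square)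
      (simp add: w_def[symmetric] a_def algebra_simps)
  also have "\<dots> = - (s * (s + a))"
  proof -
    have "a = s * (b + 1)" using nn by (simp add: s_def)
    then have "a = s * b + s" by (simp add: distrib_left)
    then have "s * a = s\<^sup>2 * b + s\<^sup>2" by (metis distrib_left mult.assoc mult.left_commute power2_eq_square)
    then show ?thesis by (simp add: algebra_simps power2_eq_square)
  qed
  finally have "s * (s + a) \<le> 0" by simp
  moreover have "s \<ge> 0" using nn by (simp add: s_def)
  ultimately have "s = 0" using nn by (auto simp: mult_le_0_iff)
  then have "a = 0" using nn by (simp add: s_def)
  then show ?thesis by (simp add: a_def w_def)
qed

text \<open>The form attains its maximum \<mu> on the compact unit sphere. Then
  \<open>mat \<mu> - A\<close> is positive semidefinite and its form vanishes at the maximizer,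
  which therefore lies in its kernel. No diagonalisation is involved.\<close>

lemma symmetric_max_eigenvalue_exists:
  fixes A :: "real^'n^'n"
  assumes sym: "transpose A = A"
  obtains \<mu> where "eigenvalue A \<mu>" "\<And>x. x \<bullet> (A *v x) \<le> \<mu> * (x \<bullet> x)"
proof -
  let ?q = "\<lambda>x. x \<bullet> (A *v x)"
  have "sphere (0::real^'n) 1 \<noteq> {}" by simp
  moreover have "continuous_on (sphere 0 1) ?q"
    by (intro continuous_intros linear_continuous_on linear_conv_bounded_linear[THEN iffD1]) simp
  ultimately obtain v where v: "v \<in> sphere 0 1" "\<And>y. y \<in> sphere 0 1 \<Longrightarrow> ?q y \<le> ?q v"
    using continuous_attains_sup[OF compact_sphere] by blast
  define \<mu> where "\<mu> = ?q v"
  have bound: "?q x \<le> \<mu> * (x \<bullet> x)" for x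
  proof (cases "x = 0")
    case False
    have "?q (x /\<^sub>R norm x) \<le> \<mu>"
      unfolding \<mu>_def by (rule v(2)) (simp add: False)
    moreover have "?q (x /\<^sub>R norm x) = ?q x / (norm x)\<^sup>2"
      by (simp add: matrix_vector_mult_scaleR power2_eq_square divide_inverse)
    ultimately have "?q x / (norm x)\<^sup>2 \<le> \<mu>" by simp
    then show ?thesis
      using False by (simp add: pos_divide_le_eq power2_norm_eq_inner)
  qed simp
  define B where "B = mat \<mu> - A"
  have mat: "(mat \<mu> :: real^'n^'n) = \<mu> *\<^sub>R mat 1" 
    by (simp add: mat_def vec_eq_iff)
  have B: "B *v x = \<mu> *\<^sub>R x - A *v x" for x
    by (simp add: B_def mat matrix_vector_mult_diff_rdistrib scaleR_matrix_vector_assoc[symmetric])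
  have "B *v v = 0"
  proof (rule psd_quadratic_form_eq_0)
    show "transpose B = B"
      using sym by (auto simp: B_def transpose_def mat_def vec_eq_iff)
    show "0 \<le> x \<bullet> (B *v x)" for x
      using bound[of x] by (simp add: B inner_diff_right)
    show "v \<bullet> (B *v v) = 0"
      using v(1) by (simp add: B inner_diff_right \<mu>_def power2_norm_eq_inner[symmetric])
  qed
  moreover have "v \<noteq> 0" using v(1) by auto
  ultimately have "eigenvalue A \<mu>" by (auto simp: eigenvalue_def B)
  with bound show ?thesis by (rule that[rotated])
qed

text \<open>Makes the \<open>Max\<close> in \<open>max_eigenvalue\<close> meaningful. Eigenvectors
  for distinct eigenvalues are orthogonal, and a pairwise orthogonal set is finite; choosing one
  eigenvector per eigenvalue is injective.\<close>

lemma finite_eigenvalues_symmetric: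
  fixes A :: "real^'n^'n"
  assumes sym: "transpose A = A"
  shows "finite {\<mu>. eigenvalue A \<mu>}"
proof -
  define w where "w \<mu> = (SOME w. w \<noteq> 0 \<and> A *v w = \<mu> *\<^sub>R w)" for \<mu>
  have w: "w \<mu> \<noteq> 0 \<and> A *v w \<mu> = \<mu> *\<^sub>R w \<mu>" if "eigenvalue A \<mu>" for \<mu>
    using that unfolding w_def eigenvalue_def by (rule someI_ex)
  have inj: "inj_on w {\<mu>. eigenvalue A \<mu>}"
    by (rule inj_onI) (metis mem_Collect_eq scaleR_right_imp_eq w)
  have "pairwise orthogonal (w ` {\<mu>. eigenvalue A \<mu>})"
  proof (rule pairwiseI, clarify)
    fix \<mu> \<nu> assume *: "eigenvalue A \<mu>" "eigenvalue A \<nu>" "w \<mu> \<noteq> w \<nu>"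
    have "\<nu> * (w \<mu> \<bullet> w \<nu>) = \<mu> * (w \<mu> \<bullet> w \<nu>)"
      using inner_symmetric_matrix[OF sym, of "w \<mu>" "w \<nu>"] w[OF *(1)] w[OF *(2)] by simp
    moreover have "\<mu> \<noteq> \<nu>" using * by auto
    ultimately show "orthogonal (w \<mu>) (w \<nu>)" by (simp add: orthogonal_def)
  qed
  then show ?thesis
    using finite_imageD inj pairwise_orthogonal_imp_finite by blast
qed

lemma max_eigenvalue_rayleigh:
  fixes A :: "real^'n^'n"
  assumes sym: "transpose A = A"
  shows "x \<bullet> (A *v x) \<le> max_eigenvalue A * (x \<bullet> x)"
proof -
  obtain \<mu> where \<mu>: "eigenvalue A \<mu>" "\<And>x. x \<bullet> (A *v x) \<le> \<mu> * (x \<bullet> x)"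
    using symmetric_max_eigenvalue_exists[OF sym] by blast
  have "\<mu> \<le> max_eigenvalue A"
    unfolding max_eigenvalue_def
    using \<mu>(1) finite_eigenvalues_symmetric[OF sym] by (intro Max_ge) auto
  then show ?thesis
    using \<mu>(2)[of x] by (meson inner_ge_zero mult_right_mono order_trans)
qed

text \<open>Links the two descriptions of a spectrum, roots of the characteristic polynomial for
  \<open>lam\<close> and eigenvectors for \<open>eigenvalue\<close>: a nontrivial kernel of
  \<open>mat \<mu> - A\<close> means that its determinant, a product of linear factors,
  vanishes.\<close>

lemma eigenvalue_iff_sorted_eigenvalues:
  fixes A :: "real^'n^'n"
  assumes "sorted_eigenvalues A lam"
  shows "eigenvalue A \<mu> \<longleftrightarrow> (\<exists>k\<in>{1..CARD('n)}. lam k = \<mu>)"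
proof -
  have mat: "(mat \<mu> :: real^'n^'n) = \<mu> *\<^sub>R mat 1" 
    by (simp add: mat_def vec_eq_iff)
  have B: "(mat \<mu> - A) *v x = \<mu> *\<^sub>R x - A *v x" for x
    by (simp add: mat matrix_vector_mult_diff_rdistrib scaleR_matrix_vector_assoc[symmetric])
  have "eigenvalue A \<mu> \<longleftrightarrow> (\<exists>x. x \<noteq> 0 \<and> (mat \<mu> - A) *v x = 0)"
    unfolding eigenvalue_def B by auto
  also have "\<dots> \<longleftrightarrow> det (mat \<mu> - A) = 0"
    using invertible_det_nz[of "mat \<mu> - A"] 
    by (metis invertible_left_inverse matrix_left_invertible_ker)
  also have "\<dots> \<longleftrightarrow> (\<exists>k\<in>{1..CARD('n)}. lam k = \<mu>)"
    using assms unfolding sorted_eigenvalues_def by auto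
  finally show ?thesis .
qed

lemma rayleigh_le_largest_sorted_eigenvalue:
  fixes A :: "real^'n^'n"
  assumes lam: "sorted_eigenvalues A lam" and sym: "transpose A = A"
  shows "x \<bullet> (A *v x) \<le> lam CARD('n) * (x \<bullet> x)"
proof -
  obtain \<mu> where \<mu>: "eigenvalue A \<mu>" "\<And>x. x \<bullet> (A *v x) \<le> \<mu> * (x \<bullet> x)"
    using symmetric_max_eigenvalue_exists[OF sym] by blast
  obtain k where k: "k \<in> {1..CARD('n)}" "lam k = \<mu>"
    using eigenvalue_iff_sorted_eigenvalues[OF lam] \<mu>(1) by blast
  then have "lam k \<le> lam CARD('n)"
    using lam unfolding sorted_eigenvalues_def by (auto elim!: mono_onD)
  then show ?thesis
    using \<mu>(2)[of x] k by (meson inner_ge_zero mult_right_mono order_trans)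
qed

section \<open>The Frobenius inner product of stacked states, and the graph Laplacian\<close>

lemma inner_matrix_mult_left:
  fixes A :: "real^'n^'m" and X :: "real^'d^'n" and Y :: "real^'d^'m"
  shows "(A ** X) \<bullet> Y = X \<bullet> (transpose A ** Y)"
proof -
  have "(A ** X) \<bullet> Y = (\<Sum>i\<in>UNIV. \<Sum>k\<in>UNIV. \<Sum>j\<in>UNIV. A $ i $ j * X $ j $ k * Y $ i $ k)"
    by (simp add: inner_vec_def matrix_matrix_mult_def sum_distrib_right)
  also have "\<dots> = (\<Sum>k\<in>UNIV. \<Sum>i\<in>UNIV. \<Sum>j\<in>UNIV. A $ i $ j * X $ j $ k * Y $ i $ k)"
    by (rule sum.swap)
  also have "\<dots> = (\<Sum>k\<in>UNIV. \<Sum>j\<in>UNIV. \<Sum>i\<in>UNIV. A $ i $ j * X $ j $ k * Y $ i $ k)"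
    by (rule sum.cong[OF refl]) (rule sum.swap)
  also have "\<dots> = (\<Sum>j\<in>UNIV. \<Sum>k\<in>UNIV. \<Sum>i\<in>UNIV. A $ i $ j * X $ j $ k * Y $ i $ k)"
    by (rule sum.swap)
  also have "\<dots> = X \<bullet> (transpose A ** Y)"
    by (simp add: inner_vec_def matrix_matrix_mult_def transpose_def sum_distrib_left mult_ac)
  finally show ?thesis .
qed

text \<open>Left multiplication acts on each column separately, so this lifts quadratic form bounds
  from vectors to stacked states.\<close>

lemma inner_eq_sum_column:
  fixes X Y :: "real^'d^'n"
  shows "X \<bullet> Y = (\<Sum>k\<in>UNIV. column k X \<bullet> column k Y)"
  unfolding inner_vec_def column_def by (simp add: sum.swap[of _ "UNIV::'d set"])

lemma column_matrix_mult:
  fixes A :: "real^'n^'m" and X :: "real^'d^'n"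
  shows "column k (A ** X) = A *v column k X"
  by (simp add: column_def matrix_matrix_mult_def matrix_vector_mult_def vec_eq_iff)

text \<open>When the square is expanded, symmetry of the weights makes the two sums of pure squares
  equal.\<close>

lemma laplacian_quadratic_form:
  fixes A :: "real^'n^'n"
  assumes "\<And>i j. A $ i $ j = A $ j $ i"
  shows "x \<bullet> (laplacian A *v x) = (1/2) * (\<Sum>i\<in>UNIV. \<Sum>j\<in>UNIV. A $ i $ j * (x $ i - x $ j)\<^sup>2)"
proof -
  define S1 where "S1 = (\<Sum>i\<in>UNIV. \<Sum>j\<in>UNIV. A $ i $ j * (x $ i)\<^sup>2)"
  define S2 where "S2 = (\<Sum>i\<in>UNIV. \<Sum>j\<in>UNIV. A $ i $ j * (x $ i * x $ j))"
  have S1': "S1 = (\<Sum>i\<in>UNIV. \<Sum>j\<in>UNIV. A $ i $ j * (x $ j)\<^sup>2)"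
    unfolding S1_def by (subst sum.swap) (simp add: assms)
  have row: "(laplacian A *v x) $ i = (\<Sum>j\<in>UNIV. A $ i $ j * x $ i) - (\<Sum>j\<in>UNIV. A $ i $ j * x $ j)" for i
    by (simp add: laplacian_def matrix_vector_mult_def left_diff_distrib sum_subtractf
        if_distrib[of "\<lambda>z. z * _"] sum_distrib_right cong: if_cong)
  have "x \<bullet> (laplacian A *v x) = S1 - S2"
    by (simp add: inner_vec_def row S1_def S2_def right_diff_distrib sum_subtractf
        sum_distrib_left power2_eq_square mult_ac)
  also have "\<dots> = (1/2) * (\<Sum>i\<in>UNIV. \<Sum>j\<in>UNIV. A $ i $ j * (x $ i - x $ j)\<^sup>2)"
  proof -
    have "(\<Sum>i\<in>UNIV. \<Sum>j\<in>UNIV. A $ i $ j * (x $ i - x $ j)\<^sup>2) = S1 + S1 - 2 * S2"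
      by (subst (2) S1') (simp add: S1_def S2_def power2_diff algebra_simps sum.distrib
          sum_subtractf sum_distrib_left)
    then show ?thesis by simp
  qed
  finally show ?thesis .
qed

lemma laplacian_symmetric:
  fixes A :: "real^'n^'n"
  assumes "connected_graph A"
  shows "transpose (laplacian A) = laplacian A"
  using assms unfolding laplacian_def transpose_def vec_eq_iff connected_graph_def by simp

lemma laplacian_psd:
  fixes A :: "real^'n^'n"
  assumes "connected_graph A"
  shows "0 \<le> x \<bullet> (laplacian A *v x)"
  using assms by (subst laplacian_quadratic_form)
    (auto simp: connected_graph_def intro!: sum_nonneg mult_nonneg_nonneg)

text \<open>A vanishing sum of nonnegative terms forces equal values at the two ends of every edge;
  induction along a path carries this to any two nodes.\<close>

lemma laplacian_kernel_constant:
  fixes A :: "real^'n^'n"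
  assumes A: "connected_graph A" and 0: "x \<bullet> (laplacian A *v x) = 0"
  shows "x $ i = x $ j"
proof -
  have nn: "0 \<le> A $ i $ j * (x $ i - x $ j)\<^sup>2" for i j
    using A by (auto simp: connected_graph_def)
  have "(\<Sum>i\<in>UNIV. \<Sum>j\<in>UNIV. A $ i $ j * (x $ i - x $ j)\<^sup>2) = 0"
    using 0 A by (subst (asm) laplacian_quadratic_form) (auto simp: connected_graph_def)
  then have z: "A $ i $ j * (x $ i - x $ j)\<^sup>2 = 0" for i j
    using nn by (simp add: sum_nonneg_eq_0_iff sum_nonneg)
  have "(i, j) \<in> (edges A)\<^sup>*" using A by (simp add: connected_graph_def)
  then show ?thesis
  proof induction
    case (step k l)
    then show ?case using z[of k l] by (auto simp: edges_def)
  qed simp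
qed

lemma laplacian_mult_nth:
  fixes A :: "real^'n^'n" and X :: "real^'d^'n"
  shows "(laplacian A ** X) $ i = (\<Sum>j\<in>UNIV. A $ i $ j *\<^sub>R (X $ i - X $ j))"
  by (simp add: vec_eq_iff laplacian_def matrix_matrix_mult_def left_diff_distrib right_diff_distrib
      sum_subtractf if_distrib[of "\<lambda>z. z * _"] sum_distrib_right cong: if_cong)

text \<open>Symmetric weights make the exchanges between neighbours cancel in the total. This is
  what keeps the sum of the integrators constant.\<close>

lemma sum_rows_laplacian_mult:
  fixes A :: "real^'n^'n" and X :: "real^'d^'n"
  assumes "connected_graph A"
  shows "(\<Sum>i\<in>UNIV. (laplacian A ** X) $ i) = 0"
proof -
  let ?S = "\<Sum>i\<in>UNIV. \<Sum>j\<in>UNIV. A $ i $ j *\<^sub>R X $ i"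
  have "(\<Sum>i\<in>UNIV. \<Sum>j\<in>UNIV. A $ i $ j *\<^sub>R X $ j) = ?S"
    using assms by (subst sum.swap) (simp add: connected_graph_def)
  then show ?thesis
    by (simp add: laplacian_mult_nth scaleR_diff_right sum_subtractf)
qed

subsection \<open>The quadratic form of E\<close>

definition join_vec :: "real^'a \<Rightarrow> real^'b \<Rightarrow> real^('a + 'b)" where
  "join_vec a b = (\<chi> i. case i of Inl k \<Rightarrow> a $ k | Inr k \<Rightarrow> b $ k)"

text \<open>Row-wise vectorisation, with the index order of \<open>kronecker\<close>: it turns
  \<open>kronecker K (mat 1)\<close> into left multiplication by \<open>K\<close>.\<close>

definition flatten_mat :: "real^'d^'r \<Rightarrow> real^('r \<times> 'd)" where
  "flatten_mat X = (\<chi> i. X $ fst i $ snd i)"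

lemma sum_UNIV_Plus:
  fixes g :: "'a::finite + 'b::finite \<Rightarrow> real"
  shows "sum g UNIV = (\<Sum>k\<in>UNIV. g (Inl k)) + (\<Sum>k\<in>UNIV. g (Inr k))"
  by (simp add: UNIV_Plus_UNIV[symmetric] sum.Plus del: UNIV_Plus_UNIV)

lemma sum_UNIV_Times:
  fixes g :: "'a::finite \<times> 'b::finite \<Rightarrow> real"
  shows "sum g UNIV = (\<Sum>i\<in>UNIV. \<Sum>j\<in>UNIV. g (i, j))"
  by (simp add: UNIV_Times_UNIV[symmetric] sum.cartesian_product del: UNIV_Times_UNIV)

lemma inner_join_vec: "join_vec a b \<bullet> join_vec c d = a \<bullet> c + b \<bullet> d"
  by (simp add: inner_vec_def sum_UNIV_Plus join_vec_def)

lemma inner_flatten_mat: "flatten_mat X \<bullet> flatten_mat Y = X \<bullet> Y"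
  by (simp add: inner_vec_def sum_UNIV_Times flatten_mat_def)

lemma block_mat_mult_join_vec:
  "block_mat A B C D *v join_vec a b = join_vec (A *v a + B *v b) (C *v a + D *v b)"
  by (auto simp: vec_eq_iff matrix_vector_mult_def sum_UNIV_Plus join_vec_def block_mat_def
      split: sum.split)

lemma kronecker_mult_flatten_mat:
  fixes X :: "real^'d^'r" and K :: "real^'r^'q"
  shows "kronecker K (mat 1 :: real^'d^'d) *v flatten_mat X = flatten_mat (K ** X)"
  by (auto simp: vec_eq_iff matrix_vector_mult_def sum_UNIV_Times flatten_mat_def kronecker_def
      mat_def matrix_matrix_mult_def if_distrib[of "\<lambda>z. z * _"] if_distrib[of "\<lambda>z. _ * z"] cong: if_cong)

lemma transpose_block_mat:
  "transpose (block_mat A B C D) = block_mat (transpose A) (transpose C) (transpose B) (transpose D)"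
  by (auto simp: vec_eq_iff transpose_def block_mat_def split: sum.split)

lemma transpose_kronecker: "transpose (kronecker A B) = kronecker (transpose A) (transpose B)"
  by (simp add: vec_eq_iff transpose_def kronecker_def)

lemma transpose_plus: "transpose (A + B) = transpose A + transpose B"
  by (simp add: vec_eq_iff transpose_def)

lemma transpose_zero: "transpose 0 = 0"
  by (simp add: vec_eq_iff transpose_def)

lemma mat_mult_vec: "mat c *v x = c *\<^sub>R (x::real^'n)"
  by (simp add: vec_eq_iff matrix_vector_mult_def mat_def if_distrib[of "\<lambda>z. z * _"] cong: if_cong)

definition reduced_laplacian :: "real^'n^'n \<Rightarrow> real^'r^'n \<Rightarrow> real^'r^'r" where
  "reduced_laplacian A R = transpose R ** laplacian A ** R"

definition reduced_inverse :: "real^'n^'n \<Rightarrow> real^'r^'n \<Rightarrow> real^'r^'r" where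
  "reduced_inverse A R = matrix_inv (reduced_laplacian A R)"

text \<open>For a connected graph and a reduction matrix \<open>R\<close> this is the Moore-Penrose
  inverse of the Laplacian, whatever the choice of \<open>R\<close>.\<close>

definition laplacian_ginverse :: "real^'n^'n \<Rightarrow> real^'r^'n \<Rightarrow> real^'n^'n" where
  "laplacian_ginverse A R = R ** reduced_inverse A R ** transpose R"

definition lyapunov ::
  "real^'n^'n \<Rightarrow> real^'r^'n \<Rightarrow> real \<Rightarrow> real \<Rightarrow> real \<Rightarrow> real^'d^'n \<Rightarrow> real^'d^'n \<Rightarrow> real" where
  "lyapunov A R \<alpha> \<beta> \<phi> Y U = \<alpha> * (\<phi> + 1) / 2 * (Y \<bullet> Y) + Y \<bullet> U + (U \<bullet> U) / (2 * \<alpha>)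
     + (\<phi> + 1) / (2 * \<beta>) * ((laplacian_ginverse A R ** U) \<bullet> U)"

context
  fixes A :: "real^'n^'n" and R :: "real^'r^'n"
  assumes graph: "connected_graph A" and R: "reduction_matrix R"
begin

lemma transpose_reduced_laplacian: "transpose (reduced_laplacian A R) = reduced_laplacian A R"
  by (simp add: reduced_laplacian_def matrix_transpose_mul laplacian_symmetric[OF graph] matrix_mul_assoc)

lemma R_orthonormal: "transpose R ** R = mat 1"
  using R by (simp add: reduction_matrix_def)

lemma R_column_sum: "(\<Sum>i\<in>UNIV. R $ i $ r) = 0"
proof -
  have "(vec 1 v* R) $ r = 0" using R by (simp add: reduction_matrix_def)
  then show ?thesis by (simp add: vector_matrix_mult_def)
qed

text \<open>For \<open>s\<close> in the kernel, the Laplacian form vanishes at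
  \<open>R *v s\<close>, so this vector is constant. The columns of \<open>R\<close> sum to zero, so
  \<open>transpose R\<close> kills it; but \<open>transpose R\<close> also returns
  \<open>s\<close>.\<close>

lemma invertible_reduced_laplacian: "invertible (reduced_laplacian A R)"
proof -
  have "s = 0" if s: "reduced_laplacian A R *v s = 0" for s
  proof -
    have eq: "transpose R *v (laplacian A *v (R *v s)) = 0"
      using s by (simp only: reduced_laplacian_def matrix_vector_mul_assoc matrix_mul_assoc)
    have "(R *v s) \<bullet> (laplacian A *v (R *v s)) = s \<bullet> (transpose R *v (laplacian A *v (R *v s)))"
      by (metis dot_lmul_matrix transpose_transpose vector_transpose_matrix)
    then have "(R *v s) \<bullet> (laplacian A *v (R *v s)) = 0" by (simp only: eq inner_zero_right)
    then have const: "(R *v s) $ i = (R *v s) $ j" for i j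
      by (rule laplacian_kernel_constant[OF graph])
    have "(transpose R *v (R *v s)) $ r = 0" for r
    proof -
      have "(transpose R *v (R *v s)) $ r = (\<Sum>i\<in>UNIV. R $ i $ r * (R *v s) $ i)"
        by (simp add: matrix_vector_mult_def transpose_def)
      \<comment> \<open>\<open>undefined\<close> serves as an arbitrary node: the constant entry no
        longer depends on \<open>i\<close> and leaves the sum.\<close>
      also have "\<dots> = (\<Sum>i\<in>UNIV. R $ i $ r * (R *v s) $ undefined)"
        by (intro sum.cong refl) (metis const)
      also have "\<dots> = 0" by (simp add: sum_distrib_right[symmetric] R_column_sum)
      finally show ?thesis .
    qed
    then have "transpose R *v (R *v s) = 0" by (simp add: vec_eq_iff)
    then show "s = 0" by (simp only: matrix_vector_mul_assoc R_orthonormal matrix_vector_mul_lid)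
  qed
  then show ?thesis
    by (metis invertible_left_inverse matrix_left_invertible_ker)
qed

lemma reduced_inverse_inverts:
  "reduced_inverse A R ** reduced_laplacian A R = mat 1" "reduced_laplacian A R ** reduced_inverse A R = mat 1"
proof -
  have "reduced_laplacian A R ** reduced_inverse A R = mat 1 \<and> reduced_inverse A R ** reduced_laplacian A R = mat 1"
    using invertible_reduced_laplacian
    unfolding reduced_inverse_def matrix_inv_def invertible_def by (rule someI_ex)
  then show "reduced_inverse A R ** reduced_laplacian A R = mat 1" "reduced_laplacian A R ** reduced_inverse A R = mat 1"
    by auto
qed

lemma transpose_reduced_inverse: "transpose (reduced_inverse A R) = reduced_inverse A R"
proof -
  have "transpose (reduced_inverse A R) ** reduced_laplacian A R = mat 1"
    using arg_cong[OF reduced_inverse_inverts(2), of transpose]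
    by (simp add: matrix_transpose_mul transpose_reduced_laplacian)
  then have "transpose (reduced_inverse A R) ** reduced_laplacian A R ** reduced_inverse A R = mat 1 ** reduced_inverse A R"
    by simp
  then show ?thesis
    by (simp add: matrix_mul_assoc[symmetric] reduced_inverse_inverts)
qed

lemma transpose_laplacian_ginverse: "transpose (laplacian_ginverse A R) = laplacian_ginverse A R"
  by (simp add: laplacian_ginverse_def matrix_transpose_mul transpose_reduced_inverse matrix_mul_assoc)

text \<open>\<open>R ** transpose R\<close> is the orthogonal projection that removes the consensus
  component, that is, the mean of the rows.\<close>

lemma RRt_mult_nth:
  fixes X :: "real^'d^'n"
  shows "(R ** transpose R ** X) $ i = X $ i - (1 / real CARD('n)) *\<^sub>R (\<Sum>j\<in>UNIV. X $ j)"
proof -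
  have "R ** transpose R = mat 1 - (\<chi> i j. 1 / real CARD('n))"
    using R by (simp add: reduction_matrix_def)
  then show ?thesis
    by (simp add: vec_eq_iff matrix_matrix_mult_def left_diff_distrib sum_subtractf mat_def
        if_distrib[of "\<lambda>z. z * _"] sum_divide_distrib cong: if_cong)
qed

lemma RRt_mult_zero_sum:
  fixes X :: "real^'d^'n"
  assumes "(\<Sum>i\<in>UNIV. X $ i) = 0"
  shows "R ** transpose R ** X = X"
  by (simp add: vec_eq_iff[where x = "R ** transpose R ** X"] RRt_mult_nth assms)

text \<open>The projection \<open>R ** transpose R\<close> fixes the Laplacian, whose rows sum to
  zero, and by transposition may be inserted on its right as well. This exposes the reduced
  Laplacian, which cancels against its inverse.\<close>

lemma ginverse_laplacian_mult: "laplacian_ginverse A R ** (laplacian A ** X) = R ** transpose R ** (X :: real^'d^'n)"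
proof -
  have "R ** transpose R ** laplacian A = laplacian A"
    by (rule RRt_mult_zero_sum) (use sum_rows_laplacian_mult[OF graph, of "mat 1"] in simp)
  from arg_cong[OF this, of transpose]
  have *: "laplacian A ** R ** transpose R = laplacian A"
    by (simp add: matrix_transpose_mul laplacian_symmetric[OF graph] matrix_mul_assoc)
  have "laplacian_ginverse A R ** laplacian A
      = R ** reduced_inverse A R ** transpose R ** (laplacian A ** R ** transpose R)"
    by (simp add: laplacian_ginverse_def *)
  also have "\<dots> = R ** (reduced_inverse A R ** reduced_laplacian A R) ** transpose R"
    by (simp add: reduced_laplacian_def matrix_mul_assoc)
  finally show ?thesis by (simp add: reduced_inverse_inverts matrix_mul_assoc)
qed

text \<open>With \<open>Z = R ** (reduced_inverse A R ** Y)\<close> the value is the Laplacian form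
  at \<open>Z\<close>, summed over the columns.\<close>

lemma reduced_inverse_psd: "0 \<le> (reduced_inverse A R ** Y) \<bullet> (Y :: real^'d^'r)"
proof -
  let ?Z = "R ** (reduced_inverse A R ** Y)"
  have "reduced_laplacian A R ** (reduced_inverse A R ** Y) = Y"
    by (simp add: matrix_mul_assoc reduced_inverse_inverts)
  then have "(reduced_inverse A R ** Y) \<bullet> Y = (reduced_inverse A R ** Y) \<bullet> (reduced_laplacian A R ** (reduced_inverse A R ** Y))"
    by simp
  also have "\<dots> = ?Z \<bullet> (laplacian A ** ?Z)"
    by (simp add: reduced_laplacian_def inner_matrix_mult_left[of R] matrix_mul_assoc[symmetric])
  also have "\<dots> = (\<Sum>k\<in>UNIV. column k ?Z \<bullet> (laplacian A *v column k ?Z))"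
    by (simp add: inner_eq_sum_column column_matrix_mult)
  also have "\<dots> \<ge> 0" by (intro sum_nonneg laplacian_psd graph)
  finally show ?thesis .
qed

lemma laplacian_ginverse_psd: "0 \<le> (laplacian_ginverse A R ** X) \<bullet> (X :: real^'d^'n)"
  using reduced_inverse_psd[of "transpose R ** X"] inner_matrix_mult_left[of R "reduced_inverse A R ** (transpose R ** X)" X]
  by (simp add: laplacian_ginverse_def matrix_mul_assoc)

lemma transpose_E_matrix: "transpose (E_matrix \<alpha> \<beta> \<phi> (laplacian A) R) = E_matrix \<alpha> \<beta> \<phi> (laplacian A) R"
  by (simp add: E_matrix_def transpose_scalar transpose_block_mat transpose_kronecker transpose_plus
      transpose_zero transpose_reduced_inverse[unfolded reduced_inverse_def reduced_laplacian_def])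

text \<open>In the coordinates \<open>P\<close>, made of the mean of \<open>Y\<close> and the
  reduced parts of \<open>Y\<close> and \<open>U\<close>, the Lyapunov function is exactly the form
  of \<open>E\<close>, and norms are preserved. \<open>U\<close> contributes no mean component
  because its rows sum to zero.\<close>

lemma lyapunov_le_max_eigenvalue:
  fixes Y U :: "real^'d^'n"
  assumes U: "(\<Sum>i\<in>UNIV. U $ i) = 0"
  shows "lyapunov A R \<alpha> \<beta> \<phi> Y U \<le>
    max_eigenvalue (E_matrix \<alpha> \<beta> \<phi> (laplacian A) R :: real^('d + ('r \<times> 'd + 'r \<times> 'd))^('d + ('r \<times> 'd + 'r \<times> 'd)))
      * (Y \<bullet> Y + U \<bullet> U)"
proof -
  let ?E = "E_matrix \<alpha> \<beta> \<phi> (laplacian A) R :: real^('d + ('r \<times> 'd + 'r \<times> 'd))^('d + ('r \<times> 'd + 'r \<times> 'd))"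
  \<comment> \<open>The factor makes \<open>p\<close> the coordinate of \<open>Y\<close> along the
    normalised all-ones vector, which completes the columns of \<open>R\<close> to an orthonormal
    basis.\<close>
  define p where "p = (1 / sqrt (real CARD('n))) *\<^sub>R (\<Sum>j\<in>UNIV. Y $ j)"
  define S where "S = transpose R ** Y"
  define T where "T = transpose R ** U"
  define P where "P = join_vec p (join_vec (flatten_mat S) (flatten_mat T))"
  have RT: "R ** T = U" unfolding T_def matrix_mul_assoc by (rule RRt_mult_zero_sum[OF U])
  have TT: "T \<bullet> T = U \<bullet> U"
    by (subst (2) RT[symmetric]) (simp add: inner_matrix_mult_left T_def)
  have ST: "S \<bullet> T = Y \<bullet> U"
    by (simp add: S_def inner_matrix_mult_left RT)
  have SS: "p \<bullet> p + S \<bullet> S = Y \<bullet> Y"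
  proof -
    have "S \<bullet> S = Y \<bullet> (R ** transpose R ** Y)"
      by (simp add: S_def inner_matrix_mult_left matrix_mul_assoc)
    also have "\<dots> = (\<Sum>i\<in>UNIV. Y $ i \<bullet> (Y $ i - (1 / real CARD('n)) *\<^sub>R (\<Sum>j\<in>UNIV. Y $ j)))"
      by (subst inner_vec_def) (simp add: RRt_mult_nth)
    also have "\<dots> = Y \<bullet> Y - (1 / real CARD('n)) * ((\<Sum>j\<in>UNIV. Y $ j) \<bullet> (\<Sum>j\<in>UNIV. Y $ j))"
      by (simp add: inner_diff_right sum_subtractf inner_vec_def[of Y Y] inner_sum_left sum_divide_distrib)
    also have "\<dots> = Y \<bullet> Y - p \<bullet> p"
      by (simp add: p_def)
    finally show ?thesis by simp
  qed
  have KT: "(reduced_inverse A R ** T) \<bullet> T = (laplacian_ginverse A R ** U) \<bullet> U"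
    by (simp add: laplacian_ginverse_def T_def inner_matrix_mult_left[of R] matrix_mul_assoc[symmetric])
  have EP: "?E *v P = (1/2) *\<^sub>R join_vec ((\<alpha> * (\<phi> + 1)) *\<^sub>R p) (join_vec
      ((\<alpha> * (\<phi> + 1)) *\<^sub>R flatten_mat S + flatten_mat T)
      (flatten_mat S + ((1 / \<alpha>) *\<^sub>R flatten_mat T + ((\<phi> + 1) / \<beta>) *\<^sub>R flatten_mat (reduced_inverse A R ** T))))"
    by (simp add: E_matrix_def P_def scaleR_matrix_vector_assoc[symmetric] block_mat_mult_join_vec
        mat_mult_vec matrix_vector_mult_add_rdistrib kronecker_mult_flatten_mat
        reduced_inverse_def reduced_laplacian_def)
  have "P \<bullet> (?E *v P) = (1/2) * (\<alpha> * (\<phi> + 1) * (p \<bullet> p + S \<bullet> S) + 2 * (S \<bullet> T) + (T \<bullet> T) / \<alpha>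
      + (\<phi> + 1) / \<beta> * ((reduced_inverse A R ** T) \<bullet> T))"
    unfolding EP by (simp add: P_def inner_join_vec inner_add_right inner_flatten_mat
        inner_commute[of T S] inner_commute[of T "reduced_inverse A R ** T"] distrib_left add_ac)
  also have "\<dots> = lyapunov A R \<alpha> \<beta> \<phi> Y U"
    by (simp add: SS ST TT KT lyapunov_def distrib_left mult_ac)
  finally have "lyapunov A R \<alpha> \<beta> \<phi> Y U = P \<bullet> (?E *v P)" ..
  also have "\<dots> \<le> max_eigenvalue ?E * (P \<bullet> P)"
    by (rule max_eigenvalue_rayleigh[OF transpose_E_matrix])
  also have "P \<bullet> P = Y \<bullet> Y + U \<bullet> U"
    using SS by (simp add: P_def inner_join_vec inner_flatten_mat TT)
  finally show ?thesis .
qed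

end

subsection \<open>Differential inequalities\<close>

lemma has_real_derivative_inner:
  fixes f g :: "real \<Rightarrow> 'a::real_inner"
  assumes "(f has_vector_derivative f') (at t)" "(g has_vector_derivative g') (at t)"
  shows "((\<lambda>t. f t \<bullet> g t) has_real_derivative f t \<bullet> g' + f' \<bullet> g t) (at t)"
  unfolding has_real_derivative_iff_has_vector_derivative
  by (rule bounded_bilinear.has_vector_derivative[OF bounded_bilinear_inner assms])

lemma has_real_derivative_exp_mult:
  "((\<lambda>r. exp (a * r)) has_real_derivative a * exp (a * r)) (at r)" for a r :: real
  by (auto intro!: derivative_eq_intros)

text \<open>The function \<open>(norm (F r - F t) + b / a) * exp (a * r)\<close> is nondecreasing in
  \<open>r\<close>, since the norm cannot fall faster than \<open>a * norm (F r - F t) + b\<close>.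
  Comparing its values at \<open>s\<close> and \<open>t\<close> gives the bound.\<close>

lemma backward_gronwall:
  fixes F :: "real \<Rightarrow> 'a::real_inner"
  assumes a: "a > 0" and st: "s \<le> t" and cont: "continuous_on {s..t} F"
    and deriv: "\<And>r. r \<in> {s<..<t} \<Longrightarrow>
      \<exists>D. (F has_vector_derivative D) (at r) \<and> norm D \<le> a * norm (F r - F t) + b"
  shows "norm (F s - F t) \<le> b / a * (exp (a * (t - s)) - 1)"
proof -
  have approx: "norm (F s - F t) + b / a \<le> exp (a * (t - s)) * (\<eta> + b / a)" if \<eta>: "\<eta> > 0" for \<eta>
  proof -
    \<comment> \<open>The norm need not be differentiable where \<open>F r = F t\<close>; adding
      \<open>\<eta>\<^sup>2\<close> under the root smooths it.\<close>
    define q where "q r = (F r - F t) \<bullet> (F r - F t) + \<eta>\<^sup>2" for r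
    define n where "n r = sqrt (q r)" for r
    define g where "g r = (n r + b / a) * exp (a * r)" for r
    have qpos: "q r > 0" for r
      unfolding q_def using \<eta> by (intro add_nonneg_pos) auto
    have npos: "n r > 0" for r using qpos by (simp add: n_def)
    have nle: "norm (F r - F t) \<le> n r" for r
      unfolding n_def q_def norm_eq_sqrt_inner by (rule real_sqrt_le_mono) simp
    have "g s \<le> g t"
    proof (rule DERIV_nonneg_imp_increasing_open[OF st])
      show "continuous_on {s..t} g"
        unfolding g_def n_def q_def by (intro continuous_intros cont)
      fix r assume "s < r" "r < t"
      then obtain D where D: "(F has_vector_derivative D) (at r)" "norm D \<le> a * norm (F r - F t) + b"
        using deriv by force
      have dF: "((\<lambda>r. F r - F t) has_vector_derivative D) (at r)"
        using has_vector_derivative_diff[OF D(1) has_vector_derivative_const, of "F t"] by simp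
      have "((\<lambda>r. (F r - F t) \<bullet> (F r - F t)) has_real_derivative 2 * ((F r - F t) \<bullet> D)) (at r)"
        using has_real_derivative_inner[OF dF dF] by (simp add: inner_commute[of D "F r - F t"])
      then have "(q has_real_derivative 2 * ((F r - F t) \<bullet> D)) (at r)"
        using DERIV_add[OF _ DERIV_const[of "\<eta>\<^sup>2"]] unfolding q_def by fastforce
      with DERIV_real_sqrt[OF qpos]
      have "((\<lambda>r. sqrt (q r)) has_real_derivative inverse (sqrt (q r)) / 2 * (2 * ((F r - F t) \<bullet> D))) (at r)"
        by (rule DERIV_chain2)
      moreover have "inverse (sqrt (q r)) / 2 * (2 * ((F r - F t) \<bullet> D)) = ((F r - F t) \<bullet> D) / n r"
        by (simp add: n_def field_simps)
      ultimately have dn: "(n has_real_derivative ((F r - F t) \<bullet> D) / n r) (at r)"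
        by (simp add: n_def[abs_def])
      have "\<bar>(F r - F t) \<bullet> D\<bar> \<le> n r * norm D"
        by (rule order_trans[OF Cauchy_Schwarz_ineq2]) (intro mult_right_mono nle, simp)
      then have "- ((F r - F t) \<bullet> D / n r) \<le> norm D"
        using npos[of r] by (simp add: field_simps abs_le_iff)
      also have "\<dots> \<le> a * n r + b"
        using D(2) mult_left_mono[OF nle[of r], of a] a by linarith
      also have "\<dots> = (n r + b / a) * a" using a by (simp add: distrib_left mult.commute)
      finally have nn: "0 \<le> (F r - F t) \<bullet> D / n r + (n r + b / a) * a" by linarith
      have product_rule: "(X + 0) * z + a * z * N = (X + N * a) * z" for X z N :: real
        by (simp add: algebra_simps)
      have "(g has_real_derivative ((F r - F t) \<bullet> D / n r + (n r + b / a) * a) * exp (a * r)) (at r)"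
        unfolding g_def
        using DERIV_mult[OF DERIV_add[OF dn DERIV_const[of "b / a"]] has_real_derivative_exp_mult[of a]]
        unfolding product_rule .
      with nn show "\<exists>y. (g has_real_derivative y) (at r) \<and> 0 \<le> y"
        by (metis exp_ge_zero mult_nonneg_nonneg)
    qed
    moreover have "n t = \<eta>" using \<eta> by (simp add: n_def q_def)
    ultimately have "(n s + b / a) * exp (a * s) \<le> (\<eta> + b / a) * exp (a * t)"
      by (simp add: g_def)
    moreover have "exp (a * t) = exp (a * (t - s)) * exp (a * s)"
      by (simp add: exp_add[symmetric] algebra_simps)
    ultimately have "(n s + b / a) * exp (a * s) \<le> ((\<eta> + b / a) * exp (a * (t - s))) * exp (a * s)"
      by (simp add: mult.assoc)
    then have "n s + b / a \<le> (\<eta> + b / a) * exp (a * (t - s))" by simp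
    then show ?thesis using nle[of s] by (simp add: mult.commute)
  qed
  \<comment> \<open>Letting \<eta> decrease to 0 removes the smoothing.\<close>
  have "((\<lambda>\<eta>. exp (a * (t - s)) * (\<eta> + b / a)) \<longlongrightarrow> exp (a * (t - s)) * (0 + b / a)) (at_right 0)"
    by (intro tendsto_intros)
  then have "norm (F s - F t) + b / a \<le> exp (a * (t - s)) * (0 + b / a)"
    by (rule tendsto_lowerbound)
      (auto simp: eventually_at_filter approx trivial_limit_at_right_real)
  then show ?thesis by (simp add: algebra_simps)
qed

text \<open>
  The time \<open>\<tau>\<close> is the one after which the linear comparison, run backwards from the
  current instant \<open>t\<close>, could first allow the gap \<open>norm (F s - F t)\<close> to exceed \<open>\<zeta> * norm (F t)\<close>.
\<close>

lemma sampling_gap_le: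
  fixes F :: "real \<Rightarrow> 'a::real_inner"
  assumes a: "a > 0" and c: "c \<ge> 0" and \<zeta>: "\<zeta> > 0" and st: "s \<le> t"
    and \<tau>: "t - s \<le> 1 / a * ln (1 + a * \<zeta> / (a + c * (1 + \<zeta>)))"
    and cont: "continuous_on {s..t} F"
    and deriv: "\<And>r. r \<in> {s<..<t} \<Longrightarrow>
      \<exists>D. (F has_vector_derivative D) (at r) \<and> norm D \<le> a * norm (F r) + c * norm (F s)"
  shows "norm (F s - F t) \<le> \<zeta> * norm (F t)"
proof -
  define H where "H = norm (F s - F t)"
  define p where "p = norm (F t)"
  define q where "q = a + c * (1 + \<zeta>)"
  define X where "X = exp (a * (t - s)) - 1"
  \<comment> \<open>By the triangle inequality, \<open>norm (F r)\<close> and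
    \<open>norm (F s)\<close> are replaced by quantities at the final time; the unknown gap
    \<open>H\<close> itself enters the inhomogeneous term.\<close>
  define b where "b = a * p + c * (p + H)"
  have q: "q > 0" using a c \<zeta> by (simp add: q_def add_pos_nonneg)
  have b: "b \<ge> 0" using a c by (simp add: b_def p_def H_def)
  have HX: "H \<le> b / a * X"
    unfolding H_def X_def
  proof (rule backward_gronwall[OF a st cont])
    fix r assume "r \<in> {s<..<t}"
    then obtain D where D: "(F has_vector_derivative D) (at r)" "norm D \<le> a * norm (F r) + c * norm (F s)"
      using deriv by blast
    have "norm (F r) \<le> norm (F r - F t) + p" "norm (F s) \<le> p + H"
      unfolding p_def H_def by norm+
    then have "a * norm (F r) + c * norm (F s) \<le> a * (norm (F r - F t) + p) + c * (p + H)"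
      using a c by (intro add_mono mult_left_mono) auto
    with D show "\<exists>D. (F has_vector_derivative D) (at r) \<and> norm D \<le> a * norm (F r - F t) + b"
      by (intro exI[of _ D]) (simp add: b_def algebra_simps)
  qed
  have "X \<le> a * \<zeta> / q"
  proof -
    have "a * (t - s) \<le> ln (1 + a * \<zeta> / q)"
      using \<tau> a by (simp add: q_def field_simps)
    moreover have "1 + a * \<zeta> / q > 0" using a \<zeta> q by (intro add_pos_nonneg) auto
    ultimately have "exp (a * (t - s)) \<le> 1 + a * \<zeta> / q"
      by (metis exp_le_cancel_iff exp_ln)
    then show ?thesis by (simp add: X_def)
  qed
  then have "b / a * X \<le> b / a * (a * \<zeta> / q)" using a b by (intro mult_left_mono) auto
  with HX have "H \<le> b / a * (a * \<zeta> / q)" by linarith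
  also have "\<dots> = b * \<zeta> / q" using a by simp
  finally have "H * q \<le> b * \<zeta>" using q by (simp add: pos_le_divide_eq)
  \<comment> \<open>\<open>H\<close> occurs on both sides; the summand
    \<open>c * \<zeta> * H\<close> in \<open>H * q\<close> cancels the one in
    \<open>b * \<zeta>\<close>. This is why the denominator in \<tau> contains
    \<open>1 + \<zeta>\<close>.\<close>
  then have "(a + c) * H \<le> (a + c) * (\<zeta> * p)" by (simp add: q_def b_def algebra_simps)
  then show ?thesis using a c by (simp add: H_def p_def)
qed

text \<open>\<open>V s * exp (\<kappa> * s)\<close> is nonincreasing on each sampling interval, and
  continuity joins the intervals, so no derivative is required at the sampling instants.\<close>

lemma piecewise_exponential_decay:
  fixes V :: "real \<Rightarrow> real"
  assumes \<Delta>: "\<Delta> > 0" and cont: "continuous_on {0..} V"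
    and deriv: "\<And>(k::nat) t. t \<in> {\<Delta> * real k <..< \<Delta> * real (Suc k)} \<Longrightarrow>
      \<exists>D. (V has_real_derivative D) (at t) \<and> D \<le> - \<kappa> * V t"
    and t: "t \<ge> 0"
  shows "V t \<le> V 0 * exp (- \<kappa> * t)"
proof -
  define g where "g s = V s * exp (\<kappa> * s)" for s
  \<comment> \<open>The right end is included, so that \<open>s\<close> may be the next sampling
    instant; the induction in \<open>nodes\<close> relies on this.\<close>
  have step: "g s \<le> g (\<Delta> * real k)" if s: "\<Delta> * real k \<le> s" "s \<le> \<Delta> * real (Suc k)" for k s
  proof (rule DERIV_nonpos_imp_decreasing_open[OF s(1)])
    have "{\<Delta> * real k..s} \<subseteq> {0..}" using \<Delta> by auto
    then have "continuous_on {\<Delta> * real k..s} V" by (rule continuous_on_subset[OF cont])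
    then show "continuous_on {\<Delta> * real k..s} g"
      unfolding g_def by (intro continuous_intros)
    fix r assume r: "\<Delta> * real k < r" "r < s"
    then obtain D where D: "(V has_real_derivative D) (at r)" "D \<le> - \<kappa> * V r"
      using deriv[of r k] s by auto
    have "(g has_real_derivative (D + \<kappa> * V r) * exp (\<kappa> * r)) (at r)"
      unfolding g_def using DERIV_mult[OF D(1) has_real_derivative_exp_mult[of \<kappa>]]
      by (simp add: algebra_simps)
    moreover have "(D + \<kappa> * V r) * exp (\<kappa> * r) \<le> 0"
      using D(2) by (intro mult_nonpos_nonneg) auto
    ultimately show "\<exists>y. (g has_real_derivative y) (at r) \<and> y \<le> 0" by blast
  qed
  have nodes: "g (\<Delta> * real k) \<le> g 0" for k
  proof (induction k)
    case (Suc k)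
    have "g (\<Delta> * real (Suc k)) \<le> g (\<Delta> * real k)" by (rule step) (use \<Delta> in auto)
    with Suc show ?case by simp
  qed simp
  define k where "k = nat \<lfloor>t / \<Delta>\<rfloor>"
  have "0 \<le> t / \<Delta>" using t \<Delta> by simp
  then have "real k \<le> t / \<Delta>" "t / \<Delta> \<le> real (Suc k)" unfolding k_def by linarith+
  then have "\<Delta> * real k \<le> t" "t \<le> \<Delta> * real (Suc k)"
    using \<Delta> by (simp_all add: field_simps)
  then have "g t \<le> g 0" using step nodes order_trans by blast
  then have "V t * exp (\<kappa> * t) \<le> V 0" by (simp add: g_def)
  then show ?thesis by (simp add: exp_minus field_simps)
qed

section \<open>Derivatives of stacked curves, gradients and the optimality condition\<close>

lemma has_vector_derivative_vec_lambda:
  fixes g :: "'n::finite \<Rightarrow> real \<Rightarrow> 'a::euclidean_space"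
  assumes "\<And>i. (g i has_vector_derivative g' i) F"
  shows "((\<lambda>t. \<chi> i. g i t) has_vector_derivative (\<chi> i. g' i)) F"
proof -
  have vec: "(\<chi> i. h i) = (\<Sum>i\<in>UNIV. axis i (h i))" for h :: "'n \<Rightarrow> 'a"
    by (simp add: vec_eq_iff axis_def)
  have "linear (axis i :: 'a \<Rightarrow> 'a^'n)" for i
    by (rule linearI) (auto simp: vec_eq_iff axis_def)
  then have "bounded_linear (axis i :: 'a \<Rightarrow> 'a^'n)" for i
    by (simp add: linear_conv_bounded_linear)
  then show ?thesis
    unfolding vec
    by (intro has_vector_derivative_sum) (rule bounded_linear.has_vector_derivative[OF _ assms])
qed

lemma bounded_linear_matrix_mult_left:
  fixes G :: "real^'n^'m"
  shows "bounded_linear (\<lambda>X :: real^'d^'n. G ** X)"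
  unfolding linear_conv_bounded_linear[symmetric]
  by (rule linearI) (simp_all add: matrix_add_ldistrib matrix_scalar_ac scalar_matrix_assoc)

text \<open>Shows that the description in \<open>gradient\<close> denotes: the vector representing
  the derivative \<open>f'\<close> is \<open>adjoint f' 1\<close>.\<close>

lemma differentiable_imp_GDERIV:
  fixes f :: "'a::euclidean_space \<Rightarrow> real"
  assumes "f differentiable (at x)"
  shows "GDERIV f x :> gradient f x"
proof -
  obtain f' where f': "(f has_derivative f') (at x)" using assms differentiable_def by blast
  have "GDERIV f x :> adjoint f' 1"
    unfolding gderiv_def using f' adjoint_works[OF has_derivative_linear[OF f']] by simp
  then show ?thesis using gradient_eqI by metis
qed

text \<open>The first-order condition, tested in the direction of the sum itself. It makes the rows
  of \<open>U\<close> sum to zero initially.\<close>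

lemma sum_gradients_minimizer:
  fixes f :: "'n::finite \<Rightarrow> 'a::euclidean_space \<Rightarrow> real"
  assumes diff: "\<And>i. f i differentiable (at z)"
    and min: "is_arg_min (\<lambda>y. \<Sum>i\<in>UNIV. f i y) (\<lambda>_. True) z"
  shows "(\<Sum>i\<in>UNIV. gradient (f i) z) = 0"
proof -
  let ?g = "\<Sum>i\<in>UNIV. gradient (f i) z"
  have "((\<lambda>y. \<Sum>i\<in>UNIV. f i y) has_derivative (\<lambda>h. \<Sum>i\<in>UNIV. h \<bullet> gradient (f i) z)) (at z)"
    using differentiable_imp_GDERIV[OF diff] unfolding gderiv_def by (intro has_derivative_sum)
  moreover have "\<forall>y\<in>UNIV. (\<Sum>i\<in>UNIV. f i z) \<le> (\<Sum>i\<in>UNIV. f i y)"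
    using min by (auto simp: is_arg_min_def not_less)
  ultimately have "(\<lambda>h. \<Sum>i\<in>UNIV. h \<bullet> gradient (f i) z) = (\<lambda>h. 0)"
    by (intro differential_zero_maxmin[of z UNIV]) auto
  from fun_cong[OF this, of ?g] have "?g \<bullet> ?g = 0" by (simp add: inner_sum_right)
  then show ?thesis by simp
qed

section \<open>The Lyapunov derivative, and spectral bounds for the Laplacian acting on stacked
  states\<close>

context
  fixes A :: "real^'n^'n" and R :: "real^'r^'n"
  assumes graph: "connected_graph A" and R: "reduction_matrix R"
begin

lemma lyapunov_has_derivative:
  fixes Y U :: "real \<Rightarrow> real^'d^'n"
  assumes Y: "(Y has_vector_derivative Y') (at t)" and U: "(U has_vector_derivative U') (at t)"
  shows "((\<lambda>t. lyapunov A R \<alpha> \<beta> \<phi> (Y t) (U t)) has_real_derivative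
    \<alpha> * (\<phi> + 1) * (Y t \<bullet> Y') + Y' \<bullet> U t + Y t \<bullet> U' + (U t \<bullet> U') / \<alpha>
      + (\<phi> + 1) / \<beta> * ((laplacian_ginverse A R ** U t) \<bullet> U')) (at t)"
proof -
  let ?G = "laplacian_ginverse A R"
  note GU = bounded_linear.has_vector_derivative[OF bounded_linear_matrix_mult_left[of ?G] U]
  have sym: "(?G ** U') \<bullet> U t = (?G ** U t) \<bullet> U'"
    by (metis inner_commute inner_matrix_mult_left transpose_laplacian_ginverse[OF graph R])
  have "((\<lambda>t. Y t \<bullet> Y t) has_real_derivative 2 * (Y t \<bullet> Y')) (at t)"
    "((\<lambda>t. U t \<bullet> U t) has_real_derivative 2 * (U t \<bullet> U')) (at t)"
    "((\<lambda>t. Y t \<bullet> U t) has_real_derivative Y' \<bullet> U t + Y t \<bullet> U') (at t)"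
    "((\<lambda>t. (?G ** U t) \<bullet> U t) has_real_derivative 2 * ((?G ** U t) \<bullet> U')) (at t)"
    using has_real_derivative_inner[OF Y Y] has_real_derivative_inner[OF U U]
      has_real_derivative_inner[OF Y U] has_real_derivative_inner[OF GU U]
    by (simp_all add: inner_commute[of Y' "Y t"] inner_commute[of U' "U t"] sym add.commute)
  note d = this
  show ?thesis
    unfolding lyapunov_def
    using DERIV_add[OF DERIV_add[OF DERIV_add[OF DERIV_cmult[OF d(1), of "\<alpha> * (\<phi> + 1) / 2"] d(3)]
          DERIV_cdivide[OF d(2), of "2 * \<alpha>"]] DERIV_cmult[OF d(4), of "(\<phi> + 1) / (2 * \<beta>)"]]
    by (simp add: add.assoc mult.assoc)
qed

text \<open>The weights in \<open>lyapunov\<close> are made for two cancellations. The generalised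
  inverse undoes the Laplacian in \<open>U'\<close>, so its term yields
  \<open>U \<bullet> Y + U \<bullet> e\<close>, and \<open>U \<bullet> Y\<close> cancels the cross
  term from \<open>Y \<bullet> Y'\<close>. The products of \<open>U\<close> with the coupling from
  \<open>Y' \<bullet> U\<close> and \<open>U \<bullet> U'\<close> cancel as well.\<close>

lemma lyapunov_derivative_eq:
  fixes Y U H e :: "real^'d^'n"
  assumes \<alpha>: "\<alpha> > 0" and \<beta>: "\<beta> > 0" and U: "(\<Sum>i\<in>UNIV. U $ i) = 0"
    and Y': "Y' = - (\<alpha> *\<^sub>R H) - \<beta> *\<^sub>R (laplacian A ** (Y + e)) - U"
    and U': "U' = (\<alpha> * \<beta>) *\<^sub>R (laplacian A ** (Y + e))"
  shows "\<alpha> * (\<phi> + 1) * (Y \<bullet> Y') + Y' \<bullet> U + Y \<bullet> U' + (U \<bullet> U') / \<alpha>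
      + (\<phi> + 1) / \<beta> * ((laplacian_ginverse A R ** U) \<bullet> U')
    = - \<alpha>\<^sup>2 * (\<phi> + 1) * (Y \<bullet> H) - \<alpha> * \<beta> * \<phi> * (Y \<bullet> (laplacian A ** (Y + e)))
      - \<alpha> * (H \<bullet> U) - U \<bullet> U + \<alpha> * (\<phi> + 1) * (U \<bullet> e)"
proof -
  define X where "X = laplacian A ** (Y + e)"
  have "(laplacian_ginverse A R ** U) \<bullet> X = U \<bullet> (laplacian_ginverse A R ** X)"
    by (simp add: inner_matrix_mult_left transpose_laplacian_ginverse[OF graph R])
  also have "\<dots> = (R ** transpose R ** U) \<bullet> (Y + e)"
    by (simp add: X_def ginverse_laplacian_mult[OF graph R] inner_matrix_mult_left
        matrix_transpose_mul)
  also have "\<dots> = U \<bullet> Y + U \<bullet> e"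
    by (simp add: RRt_mult_zero_sum[OF graph R U] inner_add_right)
  finally have G: "(laplacian_ginverse A R ** U) \<bullet> X = U \<bullet> Y + U \<bullet> e" .
  have GU': "(\<phi> + 1) / \<beta> * ((laplacian_ginverse A R ** U) \<bullet> U') = \<alpha> * (\<phi> + 1) * (U \<bullet> Y + U \<bullet> e)"
    using \<beta> by (simp add: U' X_def[symmetric] G)
  have U'_U: "(U \<bullet> U') / \<alpha> = \<beta> * (U \<bullet> X)"
    using \<alpha> by (simp add: U' X_def[symmetric])
  show ?thesis
    unfolding U'_U GU'
    by (simp add: Y' U' X_def[symmetric] inner_diff_left inner_diff_right inner_commute[of X U]
        inner_commute[of Y U] algebra_simps power2_eq_square)
qed

end

lemma laplacian_mult_psd:
  fixes X :: "real^'d^'n"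
  assumes graph: "connected_graph A"
  shows "0 \<le> X \<bullet> (laplacian A ** X)"
  unfolding inner_eq_sum_column column_matrix_mult
  by (intro sum_nonneg laplacian_psd graph)

lemma laplacian_mult_inner_commute:
  fixes X Y :: "real^'d^'n"
  assumes graph: "connected_graph A"
  shows "X \<bullet> (laplacian A ** Y) = Y \<bullet> (laplacian A ** X)"
  by (metis inner_commute inner_matrix_mult_left laplacian_symmetric[OF graph])

lemma laplacian_mult_rayleigh:
  fixes X :: "real^'d^'n"
  assumes graph: "connected_graph A" and lam: "sorted_eigenvalues (laplacian A) lam"
  shows "X \<bullet> (laplacian A ** X) \<le> lam CARD('n) * (X \<bullet> X)"
  unfolding inner_eq_sum_column column_matrix_mult sum_distrib_left
  by (intro sum_mono rayleigh_le_largest_sorted_eigenvalue[OF lam] laplacian_symmetric[OF graph])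

text \<open>With \<open>l\<close> the largest eigenvalue and \<open>Z\<close> the image of
  \<open>X\<close>, nonnegativity of the Laplacian form at \<open>X - (1/l) *\<^sub>R Z\<close>,
  combined with the Rayleigh bound at \<open>X\<close> and at \<open>Z\<close>, gives the operator
  norm bound.\<close>

lemma norm_laplacian_mult_le:
  fixes X :: "real^'d^'n"
  assumes graph: "connected_graph A" and lam: "sorted_eigenvalues (laplacian A) lam" and pos: "lam CARD('n) > 0"
  shows "norm (laplacian A ** X) \<le> lam CARD('n) * norm X"
proof -
  define l where "l = lam CARD('n)"
  define Z where "Z = laplacian A ** X"
  have l: "l > 0" using pos by (simp add: l_def)
  have "0 \<le> (X - (1/l) *\<^sub>R Z) \<bullet> (laplacian A ** (X - (1/l) *\<^sub>R Z))"
    by (rule laplacian_mult_psd[OF graph])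
  also have "laplacian A ** (X - (1/l) *\<^sub>R Z) = Z - (1/l) *\<^sub>R (laplacian A ** Z)"
    by (simp add: Z_def linear_diff linear_scale bounded_linear.linear[OF bounded_linear_matrix_mult_left])
  also have "(X - (1/l) *\<^sub>R Z) \<bullet> \<dots> = X \<bullet> Z - 2 / l * (Z \<bullet> Z) + (1/l)\<^sup>2 * (Z \<bullet> (laplacian A ** Z))"
    using laplacian_mult_inner_commute[OF graph, of X Z]
    by (simp add: inner_diff_left inner_diff_right Z_def[symmetric] power2_eq_square
        diff_divide_distrib)
  also have "\<dots> \<le> l * (X \<bullet> X) - 2 / l * (Z \<bullet> Z) + (1/l)\<^sup>2 * (l * (Z \<bullet> Z))"
    using laplacian_mult_rayleigh[OF graph lam, of X] laplacian_mult_rayleigh[OF graph lam, of Z] l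
    by (intro add_mono diff_right_mono mult_left_mono) (auto simp: Z_def l_def)
  also have "\<dots> = l * (X \<bullet> X) - (Z \<bullet> Z) / l"
    using l by (simp add: power2_eq_square)
  finally have "Z \<bullet> Z \<le> l\<^sup>2 * (X \<bullet> X)"
    using l by (simp add: field_simps power2_eq_square)
  then have "(norm Z)\<^sup>2 \<le> (l * norm X)\<^sup>2" by (simp add: power2_norm_eq_inner power_mult_distrib)
  then show ?thesis using l by (simp add: Z_def l_def[symmetric] power2_le_iff_abs_le)
qed

subsection \<open>Energy dissipation\<close>

text \<open>
  Each cross term is split by Young's inequality; taking the weight \<open>1 / \<epsilon>\<close> for the term
  \<open>U \<bullet> e\<close> makes the threshold \<open>\<zeta>\<close> match exactly.
\<close>

lemma dissipation:
  fixes Y U H e Y' U' :: "real^'d^'n" and A :: "real^'n^'n" and R :: "real^'r^'n"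
  assumes graph: "connected_graph A" and R: "reduction_matrix R"
    and lam: "sorted_eigenvalues (laplacian A) lam" "0 < lam 2" "lam 2 \<le> lam CARD('n)"
    and pos: "\<alpha> > 0" "\<beta> > 0" "\<delta> > 0" "\<phi> > 0" "\<mu> > 0" and eps: "0 < \<epsilon>" "\<epsilon> < 1"
    and phi: "2 * \<mu> * \<alpha>\<^sup>2 * (\<phi> + 1) = \<alpha>\<^sup>2 * L\<^sup>2 + \<delta>"
    and zeta: "\<zeta>\<^sup>2 * (\<alpha> * \<beta> * (lam CARD('n))\<^sup>2 * \<phi> + 4 * \<alpha>\<^sup>2 * lam 2 * (1 + \<phi>)\<^sup>2)
      = 2 * \<epsilon> * (1 - \<epsilon>) * lam 2 * min \<delta> 1"
    and mono: "\<mu> * (Y \<bullet> Y) \<le> Y \<bullet> H" and lip: "H \<bullet> H \<le> L\<^sup>2 * (Y \<bullet> Y)"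
    and e: "e \<bullet> e \<le> \<zeta>\<^sup>2 * (Y \<bullet> Y + U \<bullet> U)"
    and U: "(\<Sum>i\<in>UNIV. U $ i) = 0"
    and Y': "Y' = - (\<alpha> *\<^sub>R H) - \<beta> *\<^sub>R (laplacian A ** (Y + e)) - U"
    and U': "U' = (\<alpha> * \<beta>) *\<^sub>R (laplacian A ** (Y + e))"
  shows "\<alpha> * (\<phi> + 1) * (Y \<bullet> Y') + Y' \<bullet> U + Y \<bullet> U' + (U \<bullet> U') / \<alpha>
      + (\<phi> + 1) / \<beta> * ((laplacian_ginverse A R ** U) \<bullet> U')
    \<le> - (\<epsilon> * min (1/2) \<delta> / 2 * (Y \<bullet> Y + U \<bullet> U))"
proof -
  define y where "y = Y \<bullet> Y"
  define u where "u = U \<bullet> U"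
  define r where "r = e \<bullet> e"
  define l where "l = lam CARD('n)"
  define \<kappa> where "\<kappa> = min \<delta> 1"
  have nn: "y \<ge> 0" "u \<ge> 0" "r \<ge> 0" by (auto simp: y_def u_def r_def)
  have l: "l > 0" "lam 2 \<le> l" using lam by (auto simp: l_def)
  have "\<alpha>\<^sup>2 * (\<phi> + 1) * (\<mu> * y) \<le> \<alpha>\<^sup>2 * (\<phi> + 1) * (Y \<bullet> H)"
    using mono pos by (intro mult_left_mono) (auto simp: y_def)
  moreover have "\<alpha>\<^sup>2 * (\<phi> + 1) * (\<mu> * y) = (\<alpha>\<^sup>2 * L\<^sup>2 + \<delta>) / 2 * y"
    unfolding phi[symmetric] by simp
  \<comment> \<open>The relation defining \<phi> converts strong convexity into two parts:
    \<open>\<alpha>\<^sup>2 * L\<^sup>2 / 2 * y\<close> pays for the cross term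
    \<open>H \<bullet> U\<close> below, and \<open>\<delta> / 2 * y\<close> remains as
    decay.\<close>
  ultimately have YH: "- \<alpha>\<^sup>2 * (\<phi> + 1) * (Y \<bullet> H) \<le> - ((\<alpha>\<^sup>2 * L\<^sup>2 + \<delta>) / 2 * y)" by simp
  have "0 \<le> (\<alpha> *\<^sub>R H + U) \<bullet> (\<alpha> *\<^sub>R H + U)" by simp
  also have "\<dots> = \<alpha>\<^sup>2 * (H \<bullet> H) + 2 * \<alpha> * (H \<bullet> U) + u"
    by (simp add: inner_add_left inner_add_right inner_commute[of U H] u_def power2_eq_square
        distrib_left mult.assoc)
  also have "\<dots> \<le> \<alpha>\<^sup>2 * (L\<^sup>2 * y) + 2 * \<alpha> * (H \<bullet> U) + u"
    using lip by (simp add: y_def mult_left_mono)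
  finally have HU: "- \<alpha> * (H \<bullet> U) \<le> \<alpha>\<^sup>2 * L\<^sup>2 / 2 * y + u / 2" by simp
  \<comment> \<open>Completing the square: the Laplacian form at
    \<open>Y + (1/2) *\<^sub>R e\<close> is nonnegative, which leaves only a quarter of the form at
    \<open>e\<close>.\<close>
  have YL: "- \<alpha> * \<beta> * \<phi> * (Y \<bullet> (laplacian A ** (Y + e))) \<le> \<alpha> * \<beta> * \<phi> * (l / 4 * r)"
  proof -
    have lin: "laplacian A ** (V + c *\<^sub>R W) = laplacian A ** V + c *\<^sub>R (laplacian A ** W)" for c V and W :: "real^'d^'n"
      by (simp add: linear_add linear_scale bounded_linear.linear[OF bounded_linear_matrix_mult_left])
    have "0 \<le> (Y + (1/2) *\<^sub>R e) \<bullet> (laplacian A ** (Y + (1/2) *\<^sub>R e))"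
      by (rule laplacian_mult_psd[OF graph])
    also have "\<dots> = Y \<bullet> (laplacian A ** (Y + e)) + (e \<bullet> (laplacian A ** e)) / 4"
      using lin[of Y 1 e] laplacian_mult_inner_commute[OF graph, of e Y]
      by (simp add: lin inner_add_left inner_add_right add_divide_distrib)
    finally have "- (Y \<bullet> (laplacian A ** (Y + e))) \<le> l / 4 * r"
      using laplacian_mult_rayleigh[OF graph lam(1), of e] by (simp add: l_def r_def)
    from mult_left_mono[OF this, of "\<alpha> * \<beta> * \<phi>"] pos show ?thesis by simp
  qed
  have Ue: "\<alpha> * (\<phi> + 1) * (U \<bullet> e) \<le> (\<alpha> * (\<phi> + 1))\<^sup>2 / \<epsilon> * r + \<epsilon> / 4 * u"
  proof -
    define b where "b = \<alpha> * (\<phi> + 1)"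
    have "0 \<le> (b *\<^sub>R e - (\<epsilon> / 2) *\<^sub>R U) \<bullet> (b *\<^sub>R e - (\<epsilon> / 2) *\<^sub>R U)" by simp
    also have "\<dots> = b\<^sup>2 * r - \<epsilon> * (b * (U \<bullet> e)) + \<epsilon>\<^sup>2 / 4 * u"
      by (simp add: inner_diff_left inner_diff_right inner_commute[of e U] u_def r_def power2_eq_square
          right_diff_distrib diff_divide_distrib mult_ac)
    finally have "\<epsilon> * (b * (U \<bullet> e)) \<le> b\<^sup>2 * r + \<epsilon>\<^sup>2 / 4 * u" by simp
    also have "\<dots> = \<epsilon> * (b\<^sup>2 / \<epsilon> * r + \<epsilon> / 4 * u)"
      using eps by (simp add: distrib_left power2_eq_square)
    finally show ?thesis using eps by (simp add: b_def)
  qed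
  have err: "(\<alpha> * \<beta> * \<phi> * l / 4 + (\<alpha> * (\<phi> + 1))\<^sup>2 / \<epsilon>) * r \<le> (1 - \<epsilon>) * \<kappa> / 2 * (y + u)"
  proof -
    \<comment> \<open>Multiplying by \<open>K\<close> clears the denominators. \<open>D\<close> is
      the denominator of \<open>\<zeta>\<^sup>2\<close>: its second summand matches the
      \<open>U \<bullet> e\<close> term exactly, its first dominates because
      \<open>\<epsilon> * lam 2 \<le> l\<close>.\<close>
    define K where "K = 4 * (\<epsilon> * lam 2)"
    have K: "K > 0" using eps lam by (simp add: K_def)
    define D where "D = \<alpha> * \<beta> * l\<^sup>2 * \<phi> + 4 * \<alpha>\<^sup>2 * lam 2 * (1 + \<phi>)\<^sup>2"
    have "\<alpha> * \<beta> * \<phi> * (l * (\<epsilon> * lam 2)) \<le> \<alpha> * \<beta> * \<phi> * (l * (1 * l))"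
      using pos l lam eps by (intro mult_left_mono mult_mono) auto
    moreover have "K * (\<alpha> * \<beta> * \<phi> * l / 4 + q / \<epsilon>)
        = \<alpha> * \<beta> * \<phi> * (l * (\<epsilon> * lam 2)) + 4 * lam 2 * q" for q
      using eps by (simp add: K_def distrib_left mult_ac)
    moreover have "D = \<alpha> * \<beta> * \<phi> * (l * (1 * l)) + 4 * lam 2 * (\<alpha> * (\<phi> + 1))\<^sup>2"
      by (simp add: D_def power2_eq_square mult_ac add.commute)
    ultimately have "K * (\<alpha> * \<beta> * \<phi> * l / 4 + (\<alpha> * (\<phi> + 1))\<^sup>2 / \<epsilon>) \<le> D"
      by simp
    then have "K * (\<alpha> * \<beta> * \<phi> * l / 4 + (\<alpha> * (\<phi> + 1))\<^sup>2 / \<epsilon>) * r \<le> D * r"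
      using nn by (intro mult_right_mono)
    also have "\<dots> \<le> D * (\<zeta>\<^sup>2 * (y + u))"
      using e pos lam l by (intro mult_left_mono) (auto simp: D_def r_def y_def u_def)
    also have "\<dots> = K * ((1 - \<epsilon>) * \<kappa> / 2 * (y + u))"
    proof -
      have "D * \<zeta>\<^sup>2 = K * ((1 - \<epsilon>) * \<kappa> / 2)"
        using zeta by (simp add: K_def D_def l_def \<kappa>_def mult_ac)
      then show ?thesis by (simp only: mult.assoc[symmetric])
    qed
    finally show ?thesis using K by (simp only: mult.assoc mult_le_cancel_left_pos)
  qed
  \<comment> \<open>The coefficient of \<open>u\<close> is at most \<open>- 1/2 + \<epsilon> / 4 +
    (1 - \<epsilon>) / 2 = - \<epsilon> / 4\<close>, that of \<open>y\<close> at most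
    \<open>- \<epsilon> * \<delta> / 2\<close>. Hence the minimum of \<open>1/2\<close> and \<delta>
    in the rate.\<close>
  have fin: "- (\<delta> / 2 * y) - u / 2 + \<epsilon> / 4 * u + (1 - \<epsilon>) * \<kappa> / 2 * (y + u) \<le> - (\<epsilon> * min (1/2) \<delta> / 2 * (y + u))"
  proof -
    have "(1 - \<epsilon>) * \<kappa> \<le> (1 - \<epsilon>) * \<delta>" "(1 - \<epsilon>) * \<kappa> \<le> (1 - \<epsilon>) * 1"
      using eps by (intro mult_left_mono; simp add: \<kappa>_def)+
    moreover have "\<epsilon> * min (1/2) \<delta> \<le> \<epsilon> * \<delta>" "\<epsilon> * min (1/2) \<delta> \<le> \<epsilon> * (1/2)"
      using eps by (intro mult_left_mono; simp)+
    ultimately have "(1 - \<epsilon>) * \<kappa> + \<epsilon> * min (1/2) \<delta> - \<delta> \<le> 0"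
      "(1 - \<epsilon>) * \<kappa> + \<epsilon> * min (1/2) \<delta> - 1 + \<epsilon> / 2 \<le> 0"
      by (simp_all add: left_diff_distrib)
    then have "((1 - \<epsilon>) * \<kappa> + \<epsilon> * min (1/2) \<delta> - \<delta>) * y \<le> 0"
      "((1 - \<epsilon>) * \<kappa> + \<epsilon> * min (1/2) \<delta> - 1 + \<epsilon> / 2) * u \<le> 0"
      using nn by (simp_all add: mult_nonpos_nonneg)
    then show ?thesis by (simp add: algebra_simps add_divide_distrib diff_divide_distrib)
  qed
  have "- \<alpha>\<^sup>2 * (\<phi> + 1) * (Y \<bullet> H) - \<alpha> * \<beta> * \<phi> * (Y \<bullet> (laplacian A ** (Y + e)))
      - \<alpha> * (H \<bullet> U) - U \<bullet> U + \<alpha> * (\<phi> + 1) * (U \<bullet> e)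
    \<le> - (\<delta> / 2 * y) - u / 2 + \<epsilon> / 4 * u + (\<alpha> * \<beta> * \<phi> * l / 4 + (\<alpha> * (\<phi> + 1))\<^sup>2 / \<epsilon>) * r"
    using YH HU YL Ue by (simp add: u_def[symmetric] distrib_right add_divide_distrib)
  with err fin show ?thesis
    unfolding lyapunov_derivative_eq[OF graph R pos(1,2) U Y' U'] y_def u_def by linarith
qed

text \<open>The velocity splits into a gradient part, the part \<open>- U\<close>, and the coupling,
  which enters both components in proportion \<open>-1\<close> to \<alpha>; this proportion gives
  the factor \<open>sqrt (1 + \<alpha>\<^sup>2)\<close>.\<close>

lemma velocity_bound:
  fixes Y U H X Y' U' :: "real^'d^'n" and A :: "real^'n^'n"
  assumes graph: "connected_graph A"
    and lam: "sorted_eigenvalues (laplacian A) lam" "lam CARD('n) > 0"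
    and pos: "\<alpha> > 0" "\<beta> > 0" "L > 0" and lip: "H \<bullet> H \<le> L\<^sup>2 * (Y \<bullet> Y)"
    and Y': "Y' = - (\<alpha> *\<^sub>R H) - \<beta> *\<^sub>R (laplacian A ** X) - U"
    and U': "U' = (\<alpha> * \<beta>) *\<^sub>R (laplacian A ** X)"
  shows "norm (Y', U') \<le> (\<alpha> * L + 1) * norm (Y, U) + \<beta> * lam CARD('n) * sqrt (1 + \<alpha>\<^sup>2) * norm X"
proof -
  let ?Z = "laplacian A ** X"
  have "(norm H)\<^sup>2 \<le> (L * norm Y)\<^sup>2" using lip by (simp add: power2_norm_eq_inner power_mult_distrib)
  then have "norm H \<le> L * norm Y" using pos by (simp add: power2_le_iff_abs_le)
  also have "\<dots> \<le> L * norm (Y, U)" using pos norm_fst_le[of Y U] by simp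
  finally have H: "\<alpha> * norm H \<le> \<alpha> * L * norm (Y, U)" using pos by simp
  have U: "norm U \<le> norm (Y, U)" by (rule norm_snd_le)
  have "norm (- (\<beta> *\<^sub>R ?Z), (\<alpha> * \<beta>) *\<^sub>R ?Z) = \<beta> * sqrt (1 + \<alpha>\<^sup>2) * norm ?Z"
  proof -
    have "norm (- (\<beta> *\<^sub>R ?Z), (\<alpha> * \<beta>) *\<^sub>R ?Z) = sqrt ((\<beta> * norm ?Z)\<^sup>2 * (1 + \<alpha>\<^sup>2))"
      using pos by (simp add: norm_Pair power_mult_distrib algebra_simps)
    also have "\<dots> = \<beta> * sqrt (1 + \<alpha>\<^sup>2) * norm ?Z"
      using pos by (simp add: real_sqrt_mult)
    finally show ?thesis .
  qed
  also have "\<dots> \<le> \<beta> * sqrt (1 + \<alpha>\<^sup>2) * (lam CARD('n) * norm X)"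
    using pos by (intro mult_left_mono norm_laplacian_mult_le[OF graph lam]) auto
  finally have Z: "norm (- (\<beta> *\<^sub>R ?Z), (\<alpha> * \<beta>) *\<^sub>R ?Z) \<le> \<beta> * lam CARD('n) * sqrt (1 + \<alpha>\<^sup>2) * norm X"
    by (simp add: mult_ac)
  have "(Y', U') = (- (\<alpha> *\<^sub>R H), 0) + (- U, 0) + (- (\<beta> *\<^sub>R ?Z), (\<alpha> * \<beta>) *\<^sub>R ?Z)"
    by (simp add: Y' U')
  also have "norm \<dots> \<le> norm (- (\<alpha> *\<^sub>R H), 0::real^'d^'n) + norm (- U, 0::real^'d^'n)
      + norm (- (\<beta> *\<^sub>R ?Z), (\<alpha> * \<beta>) *\<^sub>R ?Z)"
    by (intro order_trans[OF norm_triangle_ineq] add_right_mono norm_triangle_ineq)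
  also have "\<dots> \<le> \<alpha> * L * norm (Y, U) + norm (Y, U) + \<beta> * lam CARD('n) * sqrt (1 + \<alpha>\<^sup>2) * norm X"
    using H U Z pos by (intro add_mono) (auto simp: norm_Pair)
  finally show ?thesis by (simp add: distrib_right)
qed

text \<open>The terms without \<phi> and without the generalised inverse form the square of
  \<open>\<alpha> *\<^sub>R Y + U\<close> over \<open>2 * \<alpha>\<close>. A bound on
  \<open>Y\<close> is enough for convergence of the states.\<close>

lemma lyapunov_lower_bound:
  fixes Y U :: "real^'d^'n" and A :: "real^'n^'n" and R :: "real^'r^'n"
  assumes graph: "connected_graph A" and R: "reduction_matrix R"
    and pos: "\<alpha> > 0" "\<beta> > 0" "\<phi> > 0"
  shows "\<alpha> * \<phi> / 2 * (Y \<bullet> Y) \<le> lyapunov A R \<alpha> \<beta> \<phi> Y U"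
proof -
  have "0 \<le> (\<alpha> *\<^sub>R Y + U) \<bullet> (\<alpha> *\<^sub>R Y + U) / (2 * \<alpha>)" using pos by simp
  also have "\<dots> = \<alpha> / 2 * (Y \<bullet> Y) + Y \<bullet> U + (U \<bullet> U) / (2 * \<alpha>)"
    using pos by (simp add: inner_add_left inner_add_right inner_commute[of U Y] add_divide_distrib)
  finally have "0 \<le> \<alpha> / 2 * (Y \<bullet> Y) + Y \<bullet> U + (U \<bullet> U) / (2 * \<alpha>)" .
  moreover have "0 \<le> (\<phi> + 1) / (2 * \<beta>) * ((laplacian_ginverse A R ** U) \<bullet> U)"
    using pos by (intro mult_nonneg_nonneg laplacian_ginverse_psd[OF graph R]) auto
  ultimately show ?thesis
    by (simp add: lyapunov_def distrib_left distrib_right add_divide_distrib)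
qed

subsection \<open>Convergence\<close>

theorem theorem10:
  fixes A :: "real^'n^'n"
    and lam :: "nat \<Rightarrow> real"
    and R :: "real^'r^'n"
    and f :: "'n \<Rightarrow> real^'d \<Rightarrow> real"
    and m M :: "'n \<Rightarrow> real"
    and xstar :: "real^'d"
    and \<alpha> \<beta> \<Delta> \<epsilon> \<delta> \<phi> \<zeta> \<tau> mmin Mmax rate :: real
    and E :: "real^('d::finite + ('r \<times> 'd + 'r \<times> 'd))^('d + ('r \<times> 'd + 'r \<times> 'd))"
    and x0 v0 :: "'n \<Rightarrow> real^'d"
  assumes N: "CARD('n) \<ge> 2" "CARD('r) = CARD('n) - 1"
    and graph: "connected_graph A"
    and lam: "sorted_eigenvalues (laplacian A) lam"
    and R: "reduction_matrix R"
    and m: "\<And>i. m i > 0" "\<And>i. strongly_convex (m i) (f i)"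
    and M: "\<And>i. M i > 0" "\<And>i. (M i)-lipschitz_on UNIV (gradient (f i))"
    and mmin: "mmin = Min (range m)"
    and Mmax: "Mmax = Max (range M)"
    and xstar: "is_arg_min (\<lambda>y. \<Sum>i\<in>UNIV. f i y) (\<lambda>_. True) xstar"
    and pos: "\<alpha> > 0" "\<beta> > 0" "\<delta> > 0"
    and eps: "0 < \<epsilon>" "\<epsilon> < 1"
    and phi: "\<phi> = 1 / (2 * mmin) * Mmax\<^sup>2 + 1 / (2 * mmin * \<alpha>\<^sup>2) * \<delta> - 1" "\<phi> > 0"
    and zeta: "\<zeta> > 0"
      "\<zeta>\<^sup>2 = 2 * \<epsilon> * (1 - \<epsilon>) * lam 2 * min \<delta> 1 /
         (\<alpha> * \<beta> * (lam CARD('n))\<^sup>2 * \<phi> + 4 * \<alpha>\<^sup>2 * lam 2 * (1 + \<phi>)\<^sup>2)"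
    and tau: "\<tau> = 1 / (\<alpha> * Mmax + 1) *
         ln (1 + (\<alpha> * Mmax + 1) * \<zeta> /
           (\<alpha> * Mmax + 1 + \<beta> * lam CARD('n) * sqrt (1 + \<alpha>\<^sup>2) * (1 + \<zeta>)))"
    and E: "E = E_matrix \<alpha> \<beta> \<phi> (laplacian A) R"
    and rate: "rate = 1/4 * \<epsilon> * min (1/2) \<delta> / max_eigenvalue E"
    and Delta: "\<Delta> \<in> {0<..<\<tau>}"
    and v0: "(\<Sum>i\<in>UNIV. v0 i) = 0"
  shows "rate > 0 \<and>
    (\<forall>i. \<exists>C\<ge>0. \<forall>x v.
       sampled_solution A f \<alpha> \<beta> \<Delta> x v \<and> (\<forall>j. x j 0 = x0 j \<and> v j 0 = v0 j) \<longrightarrow>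
       (\<forall>t\<ge>0. norm (x i t - xstar) \<le> C * exp (- rate * t)))"
proof -
  define g where "g i = gradient (f i)" for i
  define l where "l = lam CARD('n)"
  have mmin_le: "mmin \<le> m i" and Mmax_ge: "M i \<le> Mmax" for i
    unfolding mmin Mmax by auto
  have mmin_pos: "mmin > 0" unfolding mmin using m(1) by (subst Min_gr_iff) auto
  have Mmax_pos: "Mmax > 0" using Mmax_ge M(1) by (meson less_le_trans)
  have "lam 2 \<ge> 0"
  proof -
    have "eigenvalue (laplacian A) (lam 2)"
      using N eigenvalue_iff_sorted_eigenvalues[OF lam] by auto
    then obtain w where w: "w \<noteq> 0" "laplacian A *v w = lam 2 *\<^sub>R w" by (auto simp: eigenvalue_def)
    have "0 \<le> lam 2 * (w \<bullet> w)" using laplacian_psd[OF graph, of w] w by simp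
    then show ?thesis
      using w(1) mult_le_cancel_right_pos[of "w \<bullet> w" 0 "lam 2"] by simp
  qed
  \<comment> \<open>If \<open>lam 2\<close> were 0, the formula for \<open>\<zeta>\<^sup>2\<close>
    would give 0, against \<zeta> being positive.\<close>
  moreover have "lam 2 \<noteq> 0" using zeta by auto
  ultimately have lam2: "lam 2 > 0" by simp
  have lam2_le: "lam 2 \<le> l"
    using lam N unfolding sorted_eigenvalues_def l_def by (auto elim!: mono_onD)
  have l: "l > 0" using lam2 lam2_le by simp
  have phi': "2 * mmin * \<alpha>\<^sup>2 * (\<phi> + 1) = \<alpha>\<^sup>2 * Mmax\<^sup>2 + \<delta>"
    using phi(1) mmin_pos pos by (simp add: field_simps)
  have "\<alpha> * \<beta> * l\<^sup>2 * \<phi> + 4 * \<alpha>\<^sup>2 * lam 2 * (1 + \<phi>)\<^sup>2 > 0"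
    using pos phi(2) lam2 l by (intro add_pos_pos mult_pos_pos zero_less_power) auto
  then have zeta': "\<zeta>\<^sup>2 * (\<alpha> * \<beta> * l\<^sup>2 * \<phi> + 4 * \<alpha>\<^sup>2 * lam 2 * (1 + \<phi>)\<^sup>2)
      = 2 * \<epsilon> * (1 - \<epsilon>) * lam 2 * min \<delta> 1"
    unfolding zeta(2) l_def by simp

  let ?V = "lyapunov A R \<alpha> \<beta> \<phi> :: real^'d^'n \<Rightarrow> real^'d^'n \<Rightarrow> real"
  have V_le: "?V Y U \<le> max_eigenvalue E * (Y \<bullet> Y + U \<bullet> U)" if "(\<Sum>i\<in>UNIV. U $ i) = 0" for Y U
    unfolding E by (rule lyapunov_le_max_eigenvalue[OF graph R that])
  have V_ge: "\<alpha> * \<phi> / 2 * (Y \<bullet> Y) \<le> ?V Y U" for Y U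
    by (rule lyapunov_lower_bound[OF graph R pos(1,2) phi(2)])
  \<comment> \<open>The lower and upper bounds on the Lyapunov function are compared at a nonzero
    \<open>Y\<close> with \<open>U = 0\<close>.\<close>
  have E_pos: "max_eigenvalue E > 0"
  proof -
    define Y :: "real^'d^'n" where "Y = (\<chi> i. vec 1)"
    have "Y $ i $ j \<noteq> 0" for i j by (simp add: Y_def)
    then have "Y \<noteq> 0" by (metis zero_index)
    then have YY: "Y \<bullet> Y > 0" by simp
    then have "0 < \<alpha> * \<phi> / 2 * (Y \<bullet> Y)" using pos phi(2) by simp
    also have "\<dots> \<le> max_eigenvalue E * (Y \<bullet> Y)"
      using V_ge[of Y 0] V_le[of 0 Y] by simp
    finally show ?thesis using YY by (simp add: zero_less_mult_iff)
  qed
  have rate_pos: "rate > 0"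
    unfolding rate using E_pos eps pos by simp

  have diff: "f i differentiable (at z)" for i z
    using m(2) by (simp add: strongly_convex_def)
  have opt: "(\<Sum>i\<in>UNIV. g i xstar) = 0"
    unfolding g_def by (rule sum_gradients_minimizer[OF diff xstar])

  \<comment> \<open>The constant precedes the solution in the statement, so it is built from the
    initial data alone. The root in \<open>C\<close> appears because the Lyapunov function controls
    the squared distance.\<close>
  define V0 where "V0 = ?V (\<chi> i. x0 i - xstar) (\<chi> i. v0 i + \<alpha> *\<^sub>R g i xstar)"
  define C where "C = sqrt (2 / (\<alpha> * \<phi>) * V0)"
  have "0 \<le> V0"
    unfolding V0_def by (rule order_trans[OF _ V_ge]) (use pos phi(2) in simp)
  then have C: "C \<ge> 0" using pos phi(2) by (simp add: C_def)

  have main: "norm (x i t - xstar) \<le> C * exp (- rate * t)"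
    if sol: "sampled_solution A f \<alpha> \<beta> \<Delta> x v" and init: "\<And>j. x j 0 = x0 j \<and> v j 0 = v0 j"
      and t: "t \<ge> 0" for x v i t
  proof -
    define Y where "Y t = (\<chi> i. x i t - xstar)" for t
    define U where "U t = (\<chi> i. v i t + \<alpha> *\<^sub>R g i xstar)" for t
    define H where "H t = (\<chi> i. g i (x i t) - g i xstar)" for t
    \<comment> \<open>The argument \<open>s\<close> is the last sampling instant, at which the
      coupling is evaluated; \<open>t\<close> is the current time.\<close>
    define Y' where "Y' s t = - (\<alpha> *\<^sub>R H t) - \<beta> *\<^sub>R (laplacian A ** Y s) - U t" for s t
    define U' where "U' s = (\<alpha> * \<beta>) *\<^sub>R (laplacian A ** Y s)" for s
    have cont_x: "continuous_on {0..} (x i)" and cont_v: "continuous_on {0..} (v i)" for i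
      using sol by (auto simp: sampled_solution_def)
    have contY: "continuous_on {0..} Y" and contU: "continuous_on {0..} U"
      unfolding Y_def U_def by (intro continuous_intros continuous_on_vec_lambda cont_x cont_v)+
    have hold: "sample_hold \<Delta> y t = y (\<Delta> * real k)"
      if "t \<in> {\<Delta> * real k <..< \<Delta> * real (Suc k)}" for y :: "real \<Rightarrow> real^'d" and k t
      using that Delta by (intro sample_hold_eq) auto
    have derivY: "(Y has_vector_derivative Y' (\<Delta> * real k) t) (at t)"
      and derivU: "(U has_vector_derivative U' (\<Delta> * real k)) (at t)"
      if r: "t \<in> {\<Delta> * real k <..< \<Delta> * real (Suc k)}" for k t
    proof -
      let ?S = "\<lambda>i. \<Sum>j\<in>UNIV. A $ i $ j *\<^sub>R (x i (\<Delta> * real k) - x j (\<Delta> * real k))"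
      have LY: "(laplacian A ** Y (\<Delta> * real k)) $ i = ?S i" for i
        by (simp add: laplacian_mult_nth Y_def)
      have d: "(v i has_vector_derivative (\<alpha> * \<beta>) *\<^sub>R ?S i) (at t)"
        "(x i has_vector_derivative - \<alpha> *\<^sub>R gradient (f i) (x i t) - \<beta> *\<^sub>R ?S i - v i t) (at t)" for i
        using sol r unfolding sampled_solution_def hold[OF r, symmetric] by blast+
      have "((\<lambda>t. x i t - xstar) has_vector_derivative Y' (\<Delta> * real k) t $ i) (at t)" for i
      proof -
        have "Y' (\<Delta> * real k) t $ i = - \<alpha> *\<^sub>R gradient (f i) (x i t) - \<beta> *\<^sub>R ?S i - v i t"
          by (simp add: Y'_def H_def U_def LY g_def scaleR_diff_right)
        then show ?thesis
          using has_vector_derivative_diff[OF d(2) has_vector_derivative_const, of i xstar] by simp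
      qed
      from has_vector_derivative_vec_lambda[where g = "\<lambda>i t. x i t - xstar", OF this]
      show "(Y has_vector_derivative Y' (\<Delta> * real k) t) (at t)"
        by (simp add: Y_def[abs_def])
      have "((\<lambda>t. v i t + \<alpha> *\<^sub>R g i xstar) has_vector_derivative U' (\<Delta> * real k) $ i) (at t)" for i
        using has_vector_derivative_add[OF d(1) has_vector_derivative_const, of i "\<alpha> *\<^sub>R g i xstar"]
        by (simp add: U'_def LY)
      from has_vector_derivative_vec_lambda[where g = "\<lambda>i t. v i t + \<alpha> *\<^sub>R g i xstar", OF this]
      show "(U has_vector_derivative U' (\<Delta> * real k)) (at t)"
        by (simp add: U_def[abs_def])
    qed
    have mono: "mmin * (Y t \<bullet> Y t) \<le> Y t \<bullet> H t" for t
    proof -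
      have "mmin * (Y t $ i \<bullet> Y t $ i) \<le> Y t $ i \<bullet> H t $ i" for i
      proof -
        have "mmin * (Y t $ i \<bullet> Y t $ i) \<le> m i * (norm (x i t - xstar))\<^sup>2"
          using mmin_le by (simp add: Y_def power2_norm_eq_inner mult_right_mono)
        also have "\<dots> \<le> Y t $ i \<bullet> H t $ i"
          using m(2)[of i] by (simp add: strongly_convex_def Y_def H_def g_def)
        finally show ?thesis .
      qed
      then show ?thesis
        unfolding inner_vec_def[of "Y t"] sum_distrib_left by (intro sum_mono)
    qed
    have lip: "H t \<bullet> H t \<le> Mmax\<^sup>2 * (Y t \<bullet> Y t)" for t
    proof -
      have "H t $ i \<bullet> H t $ i \<le> Mmax\<^sup>2 * (Y t $ i \<bullet> Y t $ i)" for i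
      proof -
        have "norm (H t $ i) \<le> M i * norm (Y t $ i)"
          using lipschitz_onD[OF M(2)[of i], of "x i t" xstar]
          by (simp add: H_def Y_def g_def dist_norm)
        also have "\<dots> \<le> Mmax * norm (Y t $ i)"
          by (intro mult_right_mono Mmax_ge) simp
        finally have "(norm (H t $ i))\<^sup>2 \<le> (Mmax * norm (Y t $ i))\<^sup>2"
          by (intro power_mono) auto
        then show ?thesis by (simp add: power2_norm_eq_inner power_mult_distrib)
      qed
      then show ?thesis
        unfolding inner_vec_def[of "Y t"] inner_vec_def[of "H t"] sum_distrib_left by (intro sum_mono)
    qed
    have sumU: "(\<Sum>i\<in>UNIV. U t $ i) = 0" if "t \<ge> 0" for t
    proof -
      define S where "S t = (\<Sum>i\<in>UNIV. U t $ i)" for t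
      \<comment> \<open>The decay lemma with rate 0: the squared norm of \<open>S\<close> does not
        grow from its initial value 0.\<close>
      have "S t \<bullet> S t \<le> S 0 \<bullet> S 0 * exp (- 0 * t)"
      proof (rule piecewise_exponential_decay[where V = "\<lambda>t. S t \<bullet> S t", OF _ _ _ that])
        show "0 < \<Delta>" using Delta by simp
        show "continuous_on {0..} (\<lambda>t. S t \<bullet> S t)"
          unfolding S_def by (intro continuous_intros contU)
        fix k t assume "t \<in> {\<Delta> * real k <..< \<Delta> * real (Suc k)}"
        from derivU[OF this]
        have "(S has_vector_derivative (\<Sum>i\<in>UNIV. U' (\<Delta> * real k) $ i)) (at t)"
          unfolding S_def[abs_def]
          by (intro has_vector_derivative_sum bounded_linear.has_vector_derivative[OF bounded_linear_vec_nth])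
        moreover have "(\<Sum>i\<in>UNIV. U' (\<Delta> * real k) $ i) = 0"
          by (simp add: U'_def scaleR_sum_right[symmetric] sum_rows_laplacian_mult[OF graph])
        ultimately have "(S has_vector_derivative 0) (at t)" by simp
        from has_real_derivative_inner[OF this this]
        show "\<exists>D. ((\<lambda>t. S t \<bullet> S t) has_real_derivative D) (at t) \<and> D \<le> - 0 * (S t \<bullet> S t)"
          by auto
      qed
      moreover have "S 0 = 0"
        by (simp add: S_def U_def init sum.distrib v0 scaleR_sum_right[symmetric] opt)
      ultimately have "S t \<bullet> S t \<le> 0" by simp
      then have "S t \<bullet> S t = 0" by (rule antisym) simp
      then have "S t = 0" by simp
      then show ?thesis by (simp add: S_def)
    qed
    have gap: "norm ((Y (\<Delta> * real k), U (\<Delta> * real k)) - (Y t, U t)) \<le> \<zeta> * norm (Y t, U t)"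
      if r: "t \<in> {\<Delta> * real k <..< \<Delta> * real (Suc k)}" for k t
    proof (rule sampling_gap_le[where F = "\<lambda>t. (Y t, U t)" and a = "\<alpha> * Mmax + 1"
          and c = "\<beta> * l * sqrt (1 + \<alpha>\<^sup>2)"])
      show "0 < \<alpha> * Mmax + 1" using pos Mmax_pos by (simp add: add_pos_pos)
      show "0 \<le> \<beta> * l * sqrt (1 + \<alpha>\<^sup>2)" using pos l by simp
      show "0 < \<zeta>" by fact
      show "\<Delta> * real k \<le> t" using r by simp
      have "t - \<Delta> * real k \<le> \<Delta>" using r by (simp add: algebra_simps)
      then show "t - \<Delta> * real k \<le> 1 / (\<alpha> * Mmax + 1) * ln (1 + (\<alpha> * Mmax + 1) * \<zeta> /
          (\<alpha> * Mmax + 1 + \<beta> * l * sqrt (1 + \<alpha>\<^sup>2) * (1 + \<zeta>)))"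
        using Delta unfolding tau l_def by simp
      have "{\<Delta> * real k..t} \<subseteq> {0..}" using Delta by auto
      then show "continuous_on {\<Delta> * real k..t} (\<lambda>t. (Y t, U t))"
        by (intro continuous_on_Pair continuous_on_subset[OF contY] continuous_on_subset[OF contU])
      fix s assume "s \<in> {\<Delta> * real k<..<t}"
      then have s: "s \<in> {\<Delta> * real k <..< \<Delta> * real (Suc k)}" using r by auto
      have "norm (Y' (\<Delta> * real k) s, U' (\<Delta> * real k)) \<le> (\<alpha> * Mmax + 1) * norm (Y s, U s)
          + \<beta> * lam CARD('n) * sqrt (1 + \<alpha>\<^sup>2) * norm (Y (\<Delta> * real k))"
        by (rule velocity_bound[OF graph lam l[unfolded l_def] pos(1,2) Mmax_pos lip Y'_def U'_def])
      \<comment> \<open>The sampled \<open>Y\<close> is enlarged to the sampled pair, the form that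
        the gap estimate expects.\<close>
      also have "\<dots> \<le> (\<alpha> * Mmax + 1) * norm (Y s, U s)
          + \<beta> * l * sqrt (1 + \<alpha>\<^sup>2) * norm (Y (\<Delta> * real k), U (\<Delta> * real k))"
        unfolding l_def[symmetric] using pos l norm_fst_le[of "Y (\<Delta> * real k)" "U (\<Delta> * real k)"]
        by (intro add_left_mono mult_left_mono) auto
      finally show "\<exists>D. ((\<lambda>t. (Y t, U t)) has_vector_derivative D) (at s) \<and>
          norm D \<le> (\<alpha> * Mmax + 1) * norm (Y s, U s)
            + \<beta> * l * sqrt (1 + \<alpha>\<^sup>2) * norm (Y (\<Delta> * real k), U (\<Delta> * real k))"
        using has_vector_derivative_Pair[OF derivY[OF s] derivU[OF s]] by blast
    qed
    \<comment> \<open>The decay exponent is twice the claimed rate, since taking the square root at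
      the end halves it. This turns the factor \<open>1/2\<close> of the dissipation estimate into
      the \<open>1/4\<close> in \<open>rate\<close>.\<close>
    have "?V (Y t) (U t) \<le> ?V (Y 0) (U 0) * exp (- (2 * rate) * t)"
    proof (rule piecewise_exponential_decay[where V = "\<lambda>t. ?V (Y t) (U t)", OF _ _ _ t])
      show "0 < \<Delta>" using Delta by simp
      have "continuous_on {0..} (\<lambda>t. laplacian_ginverse A R ** U t)"
        by (rule bounded_linear.continuous_on[OF bounded_linear_matrix_mult_left contU])
      then show "continuous_on {0..} (\<lambda>t. ?V (Y t) (U t))"
        unfolding lyapunov_def using pos by (intro continuous_intros contY contU) auto
      fix k t assume r: "t \<in> {\<Delta> * real k <..< \<Delta> * real (Suc k)}"
      have t: "t \<ge> 0"
      proof -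
        have "0 \<le> \<Delta> * real k" using Delta by simp
        then show ?thesis using r by simp
      qed
      define e where "e = Y (\<Delta> * real k) - Y t"
      have Ye: "Y (\<Delta> * real k) = Y t + e" by (simp add: e_def)
      define P where "P = Y t \<bullet> Y t + U t \<bullet> U t"
      have "norm e \<le> \<zeta> * norm (Y t, U t)"
        using norm_fst_le[of e "U (\<Delta> * real k) - U t"] gap[OF r] by (simp add: e_def)
      then have "(norm e)\<^sup>2 \<le> (\<zeta> * norm (Y t, U t))\<^sup>2" by (intro power_mono) auto
      then have e: "e \<bullet> e \<le> \<zeta>\<^sup>2 * (Y t \<bullet> Y t + U t \<bullet> U t)"
        by (simp add: power2_norm_eq_inner power_mult_distrib)
      let ?D = "\<alpha> * (\<phi> + 1) * (Y t \<bullet> Y' (\<Delta> * real k) t) + Y' (\<Delta> * real k) t \<bullet> U t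
        + Y t \<bullet> U' (\<Delta> * real k) + (U t \<bullet> U' (\<Delta> * real k)) / \<alpha>
        + (\<phi> + 1) / \<beta> * ((laplacian_ginverse A R ** U t) \<bullet> U' (\<Delta> * real k))"
      have deriv: "((\<lambda>t. ?V (Y t) (U t)) has_real_derivative ?D) (at t)"
        by (rule lyapunov_has_derivative[OF graph R derivY[OF r] derivU[OF r]])
      have "?D \<le> - (\<epsilon> * min (1/2) \<delta> / 2 * P)"
        unfolding P_def
        by (rule dissipation[OF graph R lam lam2 lam2_le[unfolded l_def] pos phi(2) mmin_pos eps phi'
              zeta'[unfolded l_def] mono lip e sumU[OF t]])
          (simp_all add: Y'_def U'_def Ye)
      also have "\<epsilon> * min (1/2) \<delta> / 2 * P = 2 * rate * (max_eigenvalue E * P)"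
        using E_pos by (simp add: rate)
      also have "- \<dots> \<le> - (2 * rate) * ?V (Y t) (U t)"
        using rate_pos V_le[OF sumU[OF t]] by (simp add: P_def)
      finally show "\<exists>D. ((\<lambda>t. ?V (Y t) (U t)) has_real_derivative D) (at t) \<and>
          D \<le> - (2 * rate) * ?V (Y t) (U t)"
        using deriv by blast
    qed
    also have "?V (Y 0) (U 0) = V0"
      by (simp add: V0_def Y_def U_def init)
    finally have "\<alpha> * \<phi> / 2 * (Y t \<bullet> Y t) \<le> V0 * exp (- (2 * rate) * t)"
      using V_ge order_trans by blast
    then have YY: "Y t \<bullet> Y t \<le> 2 / (\<alpha> * \<phi>) * V0 * exp (- (2 * rate) * t)"
      using pos phi(2) by (simp add: field_simps)
    have "(norm (x i t - xstar))\<^sup>2 \<le> (norm (Y t))\<^sup>2"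
      using Finite_Cartesian_Product.norm_nth_le[of "Y t" i] by (intro power_mono) (auto simp: Y_def)
    also have "\<dots> \<le> 2 / (\<alpha> * \<phi>) * V0 * exp (- (2 * rate) * t)"
      using YY by (simp add: power2_norm_eq_inner)
    also have "\<dots> = (C * exp (- rate * t))\<^sup>2"
      using \<open>0 \<le> V0\<close> pos phi(2)
      by (simp add: C_def power_mult_distrib exp_double[symmetric] mult.assoc)
    finally show ?thesis
      by (rule power2_le_imp_le) (use C in simp)
  qed
  from rate_pos main C show ?thesis by blast
qed

end
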